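(* Let $\bar{C}$ denote the bifiltered chain complex computed by the chunk algorithm on an input bifiltered chain complex $C$. Then $\bar{C}$ and $C$ are homotopy-equivalent.
   Context: Bifiltered chain complexes. Fix a field $\mathbb{F}$. A (finitely generated) chain complex $C_*=(C_k,\partial_k)_{0\le k\le d}$ consists of the $\mathbb{F}$-vector spaces $C_k$ spanned by given finite sets of $k$-generators, and linear maps $\partial_k:C_k\to C_{k-1}$ with $\partial_{k-1}\partial_k=0$. For a chain $c$ and a generator $g$ of the same dimension, $\langle c,g\rangle\in\mathbb{F}$ is the coefficient of $g$ in $c$; "$g'$ is in the boundary of $g$" means $\langle\partial g,g'\rangle\ne 0$. On $\mathbb{R}^2$, $p\le q$ means $p_x\le q_x$ and $p_y\le q_y$. A value function assigns to each generator $g$ a value $v(g)\in\mathbb{R}^2$ such that $\langle\partial_k g,g'\rangle\ne0$ implies $v(g')\le v(g)$; the value $v(c)$ of a chain $c$ is the least common upper bound of the values of the generators in its support. For $p\in\mathbb{R}^2$, $C^p_*$ is the subcomplex of chains of value $\le p$, with the restricted boundary maps. The collection $C=(C^p_* )_{p\in\mathbb{R}^2}$ is the bifiltered chain complex; for $p\le q$ one has inclusions $C^p_*\subseteq C^q_*$. Homotopy-equivalence. Two chain maps $\alpha_*,\beta_*:C_*\to D_*$ are chain-homotopic if there are maps $\phi_k:C_k\to D_{k+1}$ with $\partial^D_{k+1}\phi_k+\phi_{k-1}\partial^C_k=\alpha_k-\beta_k$ for all $k$. Bifiltered chain complexes $C,D$ are homotopy-equivalent if there are collections of chain maps $f^p_*:C^p_*\to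 D^p_*$ and $g^p_*:D^p_*\to C^p_*$ such that, for every $p\in\mathbb{R}^2$, $g^p_*f^p_*$ and $f^p_*g^p_*$ are chain-homotopic to the identities of $C^p_*$ and $D^p_*$ respectively, and such that for all $p\le q$ the maps $f^p_*,f^q_*$ and the maps $g^p_*,g^q_*$ commute with the inclusions $C^p_*\subseteq C^q_*$, $D^p_*\subseteq D^q_*$. The chunk algorithm. Fix an injective index function $i$ that totally orders the generators consistently with the values: $v(c_1)\le v(c_2)$ and $v(c_1)\ne v(c_2)$ imply $i(c_1)<i(c_2)$. Each $k$-generator $c$ is stored as a "$k$-column", consisting of its index, its value, its dimension and its boundary (a linear combination of $(k-1)$-generators); generators and columns are identified. The local pivot of a column $c$ is the generator $c'$ of maximal index in the boundary of $c$ among those with $v(c')=v(c)$, if there is one. A column addition $c\gets c+\lambda c'$ (with $c,c'$ columns of the same dimension, $\lambda\in\mathbb{F}$) adds $\lambda$ times the boundary of column $c'$ to the boundary of column $c$. Phase I (local reduction). Initially all columns are unlabeled. Proceed in decreasing dimension, from the top dimension down to $0$. For dimension $k$, traverse the $k$-columns in increasing index order. For a $k$-column $c$: if $c$ is already labeled, do nothing. Otherwise, as long as $c$ has a local pivot and there is a $k$-column $c'$ with $i(c')<i(c)$ and the same local pivot as $c$, perform $c\gets c+\lambda c'$ with $\lambda$ chosen so that the local pivot of $c$ disappears. If at the end of this loop $c$ has no local pivot, label $c$ global; otherwise label $c$ local negative and its local pivot local positive. Phase II (compression). For each global $k$-column $c$: while the boundary of $c$ contains a generator that is local positive or local negative,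 let $c'$ be the local $(k-1)$-generator of maximal index in it. If $c'$ is local negative, remove $c'$ from the boundary of $c$. If $c'$ is local positive, let $c''$ be the (unique) local negative $k$-column with $c'$ as local pivot and perform $c\gets c+\lambda c''$ with $\lambda$ chosen so that $c'$ disappears from the boundary of $c$. Phase III (removal of local pairs). Remove all columns labeled local (positive or negative), and return the remaining (global) columns as the resulting bifiltered chain complex $\bar{C}$.
   Formalization: In Phase I the column c' added to c must be labeled local negative; with an arbitrary k-column c' of smaller index and the same local pivot (possibly local positive, hence unreduced) the output can fail to be a chain complex, so the claim would be false. *)

theory Defs
  imports Complex_Main "HOL-Library.Product_Order" "HOL-Library.Function_Algebras"
begin

section \<open>Bifiltered chain complexes\<close>

text \<open>
  \<open>bd C g g'\<close> is the coefficient of \<open>g'\<close> in the boundary of \<open>g\<close>. Chains are coefficient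
  functions \<open>'g \<Rightarrow> 'f\<close>, added pointwise; the order on \<open>real \<times> real\<close> is the componentwise one
  of \<open>Product_Order\<close>.
\<close>

record ('g, 'f) bifiltered =
  gens :: "'g set"
  gdim :: "'g \<Rightarrow> nat"
  gval :: "'g \<Rightarrow> real \<times> real"
  bd   :: "'g \<Rightarrow> 'g \<Rightarrow> 'f"

definition supp :: "('g \<Rightarrow> 'f::field) \<Rightarrow> 'g set" where
  "supp x = {g. x g \<noteq> 0}"

definition chains :: "('g, 'f::field) bifiltered \<Rightarrow> nat \<Rightarrow> ('g \<Rightarrow> 'f) set" where
  "chains C k = {x. supp x \<subseteq> {g \<in> gens C. gdim C g = k}}"

definition boundary :: "('g, 'f::field) bifiltered \<Rightarrow> ('g \<Rightarrow> 'f) \<Rightarrow> ('g \<Rightarrow> 'f)" where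
  "boundary C x = (\<lambda>g'. \<Sum>g\<in>gens C. x g * bd C g g')"

text \<open>
  The second conjunct also says that the boundary of a 0-generator is zero, that is,
  \<open>C\<^sub>-\<^sub>1 = 0\<close>. The top dimension is any upper bound of \<open>gdim C\<close> on the finite set \<open>gens C\<close>.
\<close>

definition bifiltered_complex :: "('g, 'f::field) bifiltered \<Rightarrow> bool" where
  "bifiltered_complex C \<longleftrightarrow>
     finite (gens C) \<and>
     (\<forall>g\<in>gens C. \<forall>g'. bd C g g' \<noteq> 0 \<longrightarrow>
        g' \<in> gens C \<and> gdim C g = Suc (gdim C g') \<and> gval C g' \<le> gval C g) \<and>
     (\<forall>k. \<forall>x\<in>chains C k. boundary C (boundary C x) = 0)"

text \<open>
  \<open>chain_val\<close> is meaningful for nonzero chains only: the zero chain has no generator in its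
  support and belongs to every \<open>C\<^sup>p\<close>.
\<close>

definition chain_val :: "('g, 'f::field) bifiltered \<Rightarrow> ('g \<Rightarrow> 'f) \<Rightarrow> real \<times> real" where
  "chain_val C x = Sup_fin (gval C ` supp x)"

definition subchains :: "('g, 'f::field) bifiltered \<Rightarrow> real \<times> real \<Rightarrow> nat \<Rightarrow> ('g \<Rightarrow> 'f) set" where
  "subchains C p k = {x \<in> chains C k. x = 0 \<or> chain_val C x \<le> p}"

section \<open>Homotopy equivalence\<close>

definition linear_map_on ::
    "('g \<Rightarrow> 'f::field) set \<Rightarrow> ('h \<Rightarrow> 'f) set \<Rightarrow> (('g \<Rightarrow> 'f) \<Rightarrow> ('h \<Rightarrow> 'f)) \<Rightarrow> bool" where
  "linear_map_on X Y f \<longleftrightarrow>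
     f ` X \<subseteq> Y \<and>
     (\<forall>x\<in>X. \<forall>y\<in>X. f (x + y) = f x + f y) \<and>
     (\<forall>a. \<forall>x\<in>X. f (\<lambda>g. a * x g) = (\<lambda>h. a * f x h))"

text \<open>Maps \<open>C\<^sup>p \<rightarrow> D\<^sup>p\<close> are only relevant on \<open>subchains C p\<close>; their values elsewhere are arbitrary.\<close>

definition chain_map ::
    "('g, 'f::field) bifiltered \<Rightarrow> ('h, 'f) bifiltered \<Rightarrow> real \<times> real \<Rightarrow>
     (nat \<Rightarrow> ('g \<Rightarrow> 'f) \<Rightarrow> ('h \<Rightarrow> 'f)) \<Rightarrow> bool" where
  "chain_map C D p f \<longleftrightarrow>
     (\<forall>k. linear_map_on (subchains C p k) (subchains D p k) (f k)) \<and>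
     (\<forall>k. \<forall>x\<in>subchains C p (Suc k). boundary D (f (Suc k) x) = f k (boundary C x))"

definition chain_homotopic ::
    "('g, 'f::field) bifiltered \<Rightarrow> ('h, 'f) bifiltered \<Rightarrow> real \<times> real \<Rightarrow>
     (nat \<Rightarrow> ('g \<Rightarrow> 'f) \<Rightarrow> ('h \<Rightarrow> 'f)) \<Rightarrow> (nat \<Rightarrow> ('g \<Rightarrow> 'f) \<Rightarrow> ('h \<Rightarrow> 'f)) \<Rightarrow> bool" where
  "chain_homotopic C D p \<alpha> \<beta> \<longleftrightarrow>
     (\<exists>\<phi>. (\<forall>k. linear_map_on (subchains C p k) (subchains D p (Suc k)) (\<phi> k)) \<and>
          (\<forall>k. \<forall>x\<in>subchains C p k.
             boundary D (\<phi> k x) + (if k = 0 then 0 else \<phi> (k - 1) (boundary C x)) = \<alpha> k x - \<beta> k x))"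

definition homotopy_equivalent ::
    "('g, 'f::field) bifiltered \<Rightarrow> ('h, 'f) bifiltered \<Rightarrow> bool" where
  "homotopy_equivalent C D \<longleftrightarrow>
     (\<exists>f g.
        (\<forall>p. chain_map C D p (f p) \<and> chain_map D C p (g p) \<and>
             chain_homotopic C C p (\<lambda>k x. g p k (f p k x)) (\<lambda>k x. x) \<and>
             chain_homotopic D D p (\<lambda>k y. f p k (g p k y)) (\<lambda>k y. y)) \<and>
        (\<forall>p q. p \<le> q \<longrightarrow>
             (\<forall>k. \<forall>x\<in>subchains C p k. f q k x = f p k x) \<and>
             (\<forall>k. \<forall>y\<in>subchains D p k. g q k y = g p k y)))"

section \<open>The chunk algorithm\<close>

definition index_function :: "('g, 'f) bifiltered \<Rightarrow> ('g \<Rightarrow> 'i::linorder) \<Rightarrow> bool" where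
  "index_function C idx \<longleftrightarrow>
     inj_on idx (gens C) \<and>
     (\<forall>c1\<in>gens C. \<forall>c2\<in>gens C. gval C c1 \<le> gval C c2 \<and> gval C c1 \<noteq> gval C c2 \<longrightarrow> idx c1 < idx c2)"

datatype label = Unlabeled | Global | Local_Negative | Local_Positive

text \<open>
  A state consists of the current boundaries \<open>B\<close> of the columns and their labels \<open>L\<close>. Index, value
  and dimension of a column never change. Following the definition of a column addition, the
  boundary of the column \<open>c\<close> is the only thing that changes; the columns one dimension higher are
  not rewritten in terms of a new basis.
\<close>

definition local_pivot ::
    "('g, 'f::field) bifiltered \<Rightarrow> ('g \<Rightarrow> 'i::linorder) \<Rightarrow> ('g \<Rightarrow> 'g \<Rightarrow> 'f) \<Rightarrow> 'g \<Rightarrow> 'g \<Rightarrow> bool" where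
  "local_pivot C idx B c p \<longleftrightarrow>
     B c p \<noteq> 0 \<and> gval C p = gval C c \<and>
     (\<forall>g. B c g \<noteq> 0 \<and> gval C g = gval C c \<longrightarrow> idx g \<le> idx p)"

definition column_addition ::
    "'g \<Rightarrow> 'f::field \<Rightarrow> 'g \<Rightarrow> ('g \<Rightarrow> 'g \<Rightarrow> 'f) \<Rightarrow> ('g \<Rightarrow> 'g \<Rightarrow> 'f)" where
  "column_addition c lam c' B = B(c := (\<lambda>g. B c g + lam * B c' g))"

definition exhaust :: "('s \<Rightarrow> 's \<Rightarrow> bool) \<Rightarrow> 's \<Rightarrow> 's \<Rightarrow> bool" where
  "exhaust R s t \<longleftrightarrow> R\<^sup>*\<^sup>* s t \<and> (\<nexists>u. R t u)"

inductive for_each :: "('c \<Rightarrow> 's \<Rightarrow> 's \<Rightarrow> bool) \<Rightarrow> 'c list \<Rightarrow> 's \<Rightarrow> 's \<Rightarrow> bool" for R where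
  Nil: "for_each R [] s s"
| Cons: "R c s t \<Longrightarrow> for_each R cs t u \<Longrightarrow> for_each R (c # cs) s u"

text \<open>
  Columns already labeled local positive are not used as the column \<open>c'\<close> to be added: they are
  skipped by the traversal, so their boundaries are not reduced, and adding such a column to \<open>c\<close>
  would in general destroy \<open>\<partial>\<partial> = 0\<close> in the output. Of the other columns of smaller index, which are
  all labeled when \<open>c\<close> is treated, the global ones have no local pivot; hence the requirement that
  \<open>c'\<close> be local negative.
\<close>

inductive reduction_step ::
    "('g, 'f::field) bifiltered \<Rightarrow> ('g \<Rightarrow> 'i::linorder) \<Rightarrow> ('g \<Rightarrow> label) \<Rightarrow> 'g \<Rightarrow>
     ('g \<Rightarrow> 'g \<Rightarrow> 'f) \<Rightarrow> ('g \<Rightarrow> 'g \<Rightarrow> 'f) \<Rightarrow> bool"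
  for C idx L c where
  "\<lbrakk>local_pivot C idx B c p;
    c' \<in> gens C; gdim C c' = gdim C c; idx c' < idx c; L c' = Local_Negative;
    local_pivot C idx B c' p;
    B c p + lam * B c' p = 0\<rbrakk>
   \<Longrightarrow> reduction_step C idx L c B (column_addition c lam c' B)"

inductive reduce_column ::
    "('g, 'f::field) bifiltered \<Rightarrow> ('g \<Rightarrow> 'i::linorder) \<Rightarrow> 'g \<Rightarrow>
     ('g \<Rightarrow> 'g \<Rightarrow> 'f) \<times> ('g \<Rightarrow> label) \<Rightarrow> ('g \<Rightarrow> 'g \<Rightarrow> 'f) \<times> ('g \<Rightarrow> label) \<Rightarrow> bool"
  for C idx c where
  labeled: "L c \<noteq> Unlabeled \<Longrightarrow> reduce_column C idx c (B, L) (B, L)"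
| global: "\<lbrakk>L c = Unlabeled; exhaust (reduction_step C idx L c) B B'; \<nexists>p. local_pivot C idx B' c p\<rbrakk>
    \<Longrightarrow> reduce_column C idx c (B, L) (B', L(c := Global))"
| local: "\<lbrakk>L c = Unlabeled; exhaust (reduction_step C idx L c) B B'; local_pivot C idx B' c p\<rbrakk>
    \<Longrightarrow> reduce_column C idx c (B, L) (B', L(c := Local_Negative, p := Local_Positive))"

definition phase_I ::
    "('g, 'f::field) bifiltered \<Rightarrow> ('g \<Rightarrow> 'i::linorder) \<Rightarrow>
     ('g \<Rightarrow> 'g \<Rightarrow> 'f) \<times> ('g \<Rightarrow> label) \<Rightarrow> bool" where
  "phase_I C idx s \<longleftrightarrow>
     (\<exists>cs. set cs = gens C \<and>
           sorted_wrt (\<lambda>a b. gdim C a > gdim C b \<or> gdim C a = gdim C b \<and> idx a < idx b) cs \<and>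
           for_each (reduce_column C idx) cs (bd C, \<lambda>_. Unlabeled) s)"

definition is_local :: "label \<Rightarrow> bool" where
  "is_local l \<longleftrightarrow> l = Local_Negative \<or> l = Local_Positive"

definition max_local ::
    "('g \<Rightarrow> 'i::linorder) \<Rightarrow> ('g \<Rightarrow> label) \<Rightarrow> ('g \<Rightarrow> 'g \<Rightarrow> 'f::field) \<Rightarrow> 'g \<Rightarrow> 'g \<Rightarrow> bool" where
  "max_local idx L B c c' \<longleftrightarrow>
     B c c' \<noteq> 0 \<and> is_local (L c') \<and> (\<forall>g. B c g \<noteq> 0 \<and> is_local (L g) \<longrightarrow> idx g \<le> idx c')"

inductive compression_step ::
    "('g, 'f::field) bifiltered \<Rightarrow> ('g \<Rightarrow> 'i::linorder) \<Rightarrow> ('g \<Rightarrow> label) \<Rightarrow> 'g \<Rightarrow>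
     ('g \<Rightarrow> 'g \<Rightarrow> 'f) \<Rightarrow> ('g \<Rightarrow> 'g \<Rightarrow> 'f) \<Rightarrow> bool"
  for C idx L c where
  negative: "\<lbrakk>max_local idx L B c c'; L c' = Local_Negative\<rbrakk>
    \<Longrightarrow> compression_step C idx L c B (B(c := (B c)(c' := 0)))"
| positive: "\<lbrakk>max_local idx L B c c'; L c' = Local_Positive;
    c'' \<in> gens C; gdim C c'' = gdim C c; L c'' = Local_Negative; local_pivot C idx B c'' c';
    B c c' + lam * B c'' c' = 0\<rbrakk>
    \<Longrightarrow> compression_step C idx L c B (column_addition c lam c'' B)"

text \<open>The global columns may be compressed in any order.\<close>

definition phase_II ::
    "('g, 'f::field) bifiltered \<Rightarrow> ('g \<Rightarrow> 'i::linorder) \<Rightarrow> ('g \<Rightarrow> label) \<Rightarrow>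
     ('g \<Rightarrow> 'g \<Rightarrow> 'f) \<Rightarrow> ('g \<Rightarrow> 'g \<Rightarrow> 'f) \<Rightarrow> bool" where
  "phase_II C idx L B B' \<longleftrightarrow>
     (\<exists>cs. set cs = {c \<in> gens C. L c = Global} \<and> distinct cs \<and>
           for_each (\<lambda>c. exhaust (compression_step C idx L c)) cs B B')"

definition phase_III ::
    "('g, 'f::field) bifiltered \<Rightarrow> ('g \<Rightarrow> label) \<Rightarrow> ('g \<Rightarrow> 'g \<Rightarrow> 'f) \<Rightarrow> ('g, 'f) bifiltered" where
  "phase_III C L B =
     \<lparr>gens = {c \<in> gens C. \<not> is_local (L c)}, gdim = gdim C, gval = gval C, bd = B\<rparr>"

definition chunk_output ::
    "('g, 'f::field) bifiltered \<Rightarrow> ('g \<Rightarrow> 'i::linorder) \<Rightarrow> ('g, 'f) bifiltered \<Rightarrow> bool" where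
  "chunk_output C idx Cbar \<longleftrightarrow>
     (\<exists>B L B'. phase_I C idx (B, L) \<and> phase_II C idx L B B' \<and> Cbar = phase_III C L B')"

end

theory Submission
  imports Defs
begin

text \<open>
  Phase I splits the generators into local negative ones \<open>N\<close>, local positive ones \<open>P\<close> and global
  ones \<open>G\<close>. The whole argument rests on one fact: the block \<open>\<partial>\<^sub>P\<^sub>N\<close> of the boundary, from \<open>N\<close> to
  \<open>P\<close>, is invertible, and its inverse \<open>h\<close> raises the dimension by one without raising values.

  Given such an \<open>h\<close>, the complex splits. Call \<open>core\<close> the chains \<open>x\<close> without \<open>P\<close>-part for which
  \<open>\<partial> x\<close> has no \<open>P\<close>-part either. Since \<open>\<partial>\<partial> = 0\<close>, this is a subcomplex. By injectivity of
  \<open>\<partial>\<^sub>P\<^sub>N\<close> an element of the core is determined by its \<open>G\<close>-part, and \<open>y - h (\<partial> y)\<close> is the element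
  with \<open>G\<close>-part \<open>y\<close>. The map \<open>x - \<partial> (h x) - h (\<partial> x)\<close> is a projection onto the core, and \<open>h\<close> is,
  up to sign, the chain homotopy that connects it to the identity. So everything comes down to the
  claim that the output of the algorithm is the core written in \<open>G\<close>-coordinates: the boundary
  column of a global \<open>c\<close> must be the \<open>G\<close>-part of the boundary of the core element with leading term
  \<open>c\<close>. That element is \<open>c - h (\<partial> c)\<close>, so its value is at most that of \<open>c\<close>
  (\<open>bifiltered_complex_D\<close>, \<open>homotopy_equivalent_D\<close>).

  The algorithm provides both ingredients. Every negative or global column left by phase I is the boundary
  \<open>\<partial> z\<close> of a chain \<open>z\<close> consisting of the generator itself plus negative generators of smaller
  index (\<open>reduction_invariant\<close>). The local pivot of a negative column is its largest entry with
  respect to the index, and distinct negative columns have distinct pivots. Hence \<open>\<partial>\<^sub>P\<^sub>N\<close> is triangular up to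
  a change of basis in \<open>N\<close> and therefore invertible (\<open>cancellable_local_pairs\<close>). Phase II adds
  further negative columns to a global column until its \<open>P\<close>-entries vanish, so that the column is
  the boundary of an element of the core, except at the \<open>N\<close>-entries; and these are erased
  (\<open>compression_invariant\<close>). Both phases terminate since each step lowers the largest index of an
  entry that still has to be removed (\<open>elimination_rank\<close>).
\<close>

section \<open>Chains and boundaries\<close>

text \<open>
  Membership in \<open>C\<^sup>p\<close> is a condition on single coefficients, so that the least upper bound in
  \<open>chain_val\<close> never has to be computed.
\<close>

lemma mem_subchains_iff:
  fixes C :: "('g, 'f::field) bifiltered"
  assumes "finite (gens C)"
  shows "x \<in> subchains C p k \<longleftrightarrow>
    (\<forall>g. x g \<noteq> 0 \<longrightarrow> g \<in> gens C \<and> gdim C g = k \<and> gval C g \<le> p)"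
proof (cases "x \<in> chains C k \<and> x \<noteq> 0")
  case True
  then have sub: "supp x \<subseteq> {g \<in> gens C. gdim C g = k}" and "supp x \<noteq> {}"
    by (auto simp: chains_def supp_def zero_fun_def)
  moreover have "finite (supp x)"
    using sub assms by (auto intro: finite_subset)
  ultimately have "chain_val C x \<le> p \<longleftrightarrow> (\<forall>g\<in>supp x. gval C g \<le> p)"
    unfolding chain_val_def by (subst Sup_fin.bounded_iff) auto
  with True sub show ?thesis
    by (auto simp: subchains_def supp_def)
next
  case False
  then show ?thesis
    by (auto simp: subchains_def chains_def supp_def)
qed

definition single :: "'g \<Rightarrow> 'g \<Rightarrow> 'f::field" where
  "single c = (\<lambda>g. if g = c then 1 else 0)"

locale filtered_complex =
  fixes C :: "('g, 'f::field) bifiltered"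
  assumes complex: "bifiltered_complex C"
begin

abbreviation bdry ("\<partial>") where "\<partial> \<equiv> boundary C"

lemma finite_gens: "finite (gens C)"
  using complex by (simp add: bifiltered_complex_def)

lemmas subchains_iff = mem_subchains_iff[OF finite_gens]

lemma bd_nonzeroD:
  assumes "bd C g g' \<noteq> 0" "g \<in> gens C"
  shows "g' \<in> gens C" "gdim C g = Suc (gdim C g')" "gval C g' \<le> gval C g"
  using complex assms by (auto simp: bifiltered_complex_def)

lemma boundary_add: "\<partial> (x + y) = \<partial> x + \<partial> y"
  by (simp add: boundary_def plus_fun_def fun_eq_iff distrib_right sum.distrib)

lemma boundary_diff: "\<partial> (x - y) = \<partial> x - \<partial> y"
  by (simp add: boundary_def fun_diff_def fun_eq_iff left_diff_distrib sum_subtractf)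

lemma boundary_scale: "\<partial> (\<lambda>g. a * x g) = (\<lambda>g. a * \<partial> x g)"
  by (simp add: boundary_def fun_eq_iff sum_distrib_left mult.assoc)

lemma boundary_zero: "\<partial> 0 = 0"
  by (simp add: boundary_def fun_eq_iff zero_fun_def)

lemma boundary_linear_combination: "\<partial> (\<lambda>g. \<Sum>c\<in>A. a c * z c g) = (\<lambda>g. \<Sum>c\<in>A. a c * \<partial> (z c) g)"
  unfolding boundary_def fun_eq_iff sum_distrib_left sum_distrib_right
  by (subst sum.swap) (simp add: mult.assoc)

lemma boundary_single:
  assumes "c \<in> gens C"
  shows "\<partial> (single c) = bd C c"
proof
  fix g
  have "\<partial> (single c) g = (\<Sum>c'\<in>gens C. if c' = c then bd C c' g else 0)"
    by (auto simp: boundary_def single_def intro: sum.cong)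
  with assms finite_gens show "\<partial> (single c) g = bd C c g" by simp
qed

lemma boundary_nonzeroE:
  assumes "\<partial> x g' \<noteq> 0"
  obtains g where "x g \<noteq> 0" "g \<in> gens C" "g' \<in> gens C" "gdim C g = Suc (gdim C g')"
    "gval C g' \<le> gval C g"
proof -
  obtain g where "g \<in> gens C" "x g * bd C g g' \<noteq> 0"
    using assms unfolding boundary_def by (meson sum.not_neutral_contains_not_neutral)
  with that bd_nonzeroD show ?thesis by auto
qed

text \<open>
  \<open>boundary\<close> only reads coefficients at generators, so that the identity extends from homogeneous
  chains to arbitrary functions by linearity.
\<close>

lemma boundary_boundary: "\<partial> (\<partial> x) = 0"
proof
  fix h
  have "\<partial> (bd C g) = 0" if "g \<in> gens C" for g
  proof -
    have "single g \<in> chains C (gdim C g)"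
      using that by (auto simp: chains_def supp_def single_def split: if_splits)
    then have "\<partial> (\<partial> (single g)) = 0"
      using complex by (auto simp: bifiltered_complex_def)
    with that show ?thesis by (simp add: boundary_single)
  qed
  then have "(\<Sum>g\<in>gens C. x g * \<partial> (bd C g) h) = 0" by (simp add: zero_fun_def)
  moreover have "\<partial> (\<partial> x) = \<partial> (\<lambda>g'. \<Sum>g\<in>gens C. x g * bd C g g')"
    by (simp add: boundary_def)
  ultimately show "\<partial> (\<partial> x) h = 0 h"
    by (simp add: boundary_linear_combination zero_fun_def)
qed

lemma boundary_subchains: "x \<in> subchains C p (Suc k) \<Longrightarrow> \<partial> x \<in> subchains C p k"
  by (fastforce simp: subchains_iff elim!: boundary_nonzeroE intro: order_trans)

lemma boundary_subchains_0: "x \<in> subchains C p 0 \<Longrightarrow> \<partial> x = 0"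
  by (rule ext, rule ccontr) (force simp: subchains_iff elim!: boundary_nonzeroE)

end

section \<open>Cancelling an invertible block\<close>

definition restrict :: "'g set \<Rightarrow> ('g \<Rightarrow> 'f::field) \<Rightarrow> 'g \<Rightarrow> 'f" where
  "restrict A x = (\<lambda>g. if g \<in> A then x g else 0)"

text \<open>
  Abstract setting for the removal of local pairs: the block of \<open>\<partial>\<close> from \<open>N\<close> to \<open>P\<close> is invertible.
  The last clause of \<open>solvable\<close> says at once that the inverse is homogeneous of degree one and that
  it respects all filtration steps.
\<close>

locale cancellable = filtered_complex C for C :: "('g, 'f::field) bifiltered" +
  fixes N P :: "'g set"
  assumes N_gens: "N \<subseteq> gens C" and disjoint: "N \<inter> P = {}"
    and kernel_trivial: "\<And>u. supp u \<subseteq> N \<Longrightarrow> (\<And>p. p \<in> P \<Longrightarrow> \<partial> u p = 0) \<Longrightarrow> u = 0"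
    and solvable: "\<And>x. \<exists>u. supp u \<subseteq> N \<and> (\<forall>p\<in>P. \<partial> u p = x p) \<and>
      (\<forall>n. u n \<noteq> 0 \<longrightarrow> (\<exists>p\<in>P. x p \<noteq> 0 \<and> gdim C n = Suc (gdim C p) \<and> gval C n \<le> gval C p))"
begin

definition G :: "'g set" where "G = gens C - N - P"

text \<open>
  The inverse of the block, applied to the \<open>P\<close>-part of a chain. Its linearity follows from the
  uniqueness of the solution (\<open>h_eqI\<close>).
\<close>

definition h :: "('g \<Rightarrow> 'f) \<Rightarrow> 'g \<Rightarrow> 'f" where
  "h x = (THE u. supp u \<subseteq> N \<and> (\<forall>p\<in>P. \<partial> u p = x p))"

lemma h_eqI:
  assumes "supp u \<subseteq> N" "\<And>p. p \<in> P \<Longrightarrow> \<partial> u p = x p"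
  shows "h x = u"
  unfolding h_def
proof (rule the_equality)
  fix v assume v: "supp v \<subseteq> N \<and> (\<forall>p\<in>P. \<partial> v p = x p)"
  have "v - u = 0"
  proof (rule kernel_trivial)
    show "supp (v - u) \<subseteq> N" using v assms(1) by (force simp: supp_def)
    show "\<partial> (v - u) p = 0" if "p \<in> P" for p
      using v assms(2) that by (simp add: boundary_diff)
  qed
  then show "v = u" by simp
qed (use assms in auto)

lemma h_props:
  shows supp_h: "supp (h x) \<subseteq> N"
    and boundary_h: "p \<in> P \<Longrightarrow> \<partial> (h x) p = x p"
    and h_nonzero: "h x n \<noteq> 0 \<Longrightarrow>
      \<exists>p\<in>P. x p \<noteq> 0 \<and> gdim C n = Suc (gdim C p) \<and> gval C n \<le> gval C p"
proof -
  obtain u where u: "supp u \<subseteq> N" "\<forall>p\<in>P. \<partial> u p = x p"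
    "\<forall>n. u n \<noteq> 0 \<longrightarrow> (\<exists>p\<in>P. x p \<noteq> 0 \<and> gdim C n = Suc (gdim C p) \<and> gval C n \<le> gval C p)"
    using solvable by blast
  then have "h x = u" by (intro h_eqI) auto
  with u show "supp (h x) \<subseteq> N" "p \<in> P \<Longrightarrow> \<partial> (h x) p = x p" 
    "h x n \<noteq> 0 \<Longrightarrow> \<exists>p\<in>P. x p \<noteq> 0 \<and> gdim C n = Suc (gdim C p) \<and> gval C n \<le> gval C p"
    by auto
qed

lemma h_outside_N: "g \<notin> N \<Longrightarrow> h x g = 0"
  using supp_h by (force simp: supp_def)

lemma h_add: "h (x + y) = h x + h y"
proof (rule h_eqI)
  show "supp (h x + h y) \<subseteq> N" using h_outside_N by (fastforce simp: supp_def)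
qed (simp add: boundary_add boundary_h)

lemma h_scale: "h (\<lambda>g. a * x g) = (\<lambda>g. a * h x g)"
proof (rule h_eqI)
  show "supp (\<lambda>g. a * h x g) \<subseteq> N" using h_outside_N by (fastforce simp: supp_def)
qed (simp add: boundary_scale boundary_h)

lemma h_zero_on_P: "(\<And>p. p \<in> P \<Longrightarrow> x p = 0) \<Longrightarrow> h x = 0"
  by (rule h_eqI) (auto simp: supp_def boundary_zero)

lemma h_subchains: "x \<in> subchains C p k \<Longrightarrow> h x \<in> subchains C p (Suc k)"
  unfolding subchains_iff
proof (intro allI impI)
  fix n assume x: "\<forall>g. x g \<noteq> 0 \<longrightarrow> g \<in> gens C \<and> gdim C g = k \<and> gval C g \<le> p"
    and n: "h x n \<noteq> 0"
  from n have "n \<in> gens C" using N_gens h_outside_N by blast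
  moreover from n obtain q where "x q \<noteq> 0" "gdim C n = Suc (gdim C q)" "gval C n \<le> gval C q"
    using h_nonzero by blast
  ultimately show "n \<in> gens C \<and> gdim C n = Suc k \<and> gval C n \<le> p"
    using x by (metis order_trans)
qed

text \<open>
  The two homotopy equivalences: \<open>incl\<close> from the complex on \<open>G\<close> to the given one, \<open>proj\<close> in the other
  direction.
\<close>

definition incl :: "('g \<Rightarrow> 'f) \<Rightarrow> 'g \<Rightarrow> 'f" where
  "incl y = y - h (\<partial> y)"

definition proj :: "('g \<Rightarrow> 'f) \<Rightarrow> 'g \<Rightarrow> 'f" where
  "proj x = restrict G (x - \<partial> (h x))"

definition core :: "('g \<Rightarrow> 'f) set" where
  "core = {x. supp x \<subseteq> G \<union> N \<and> (\<forall>p\<in>P. \<partial> x p = 0)}"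

text \<open>
  Two elements with equal \<open>G\<close>-part differ by a combination of \<open>N\<close> whose boundary has no \<open>P\<close>-part.
\<close>

lemma core_eqI:
  assumes "x \<in> core" "y \<in> core" "\<And>g. g \<in> G \<Longrightarrow> x g = y g"
  shows "x = y"
proof -
  have "x - y = 0"
  proof (rule kernel_trivial)
    show "supp (x - y) \<subseteq> N" using assms by (force simp: core_def supp_def)
    show "\<partial> (x - y) p = 0" if "p \<in> P" for p
      using assms that by (simp add: core_def boundary_diff)
  qed
  then show ?thesis by simp
qed

lemma incl_on_G: "g \<in> G \<Longrightarrow> incl y g = y g"
  by (simp add: incl_def G_def h_outside_N)

lemma incl_in_core:
  assumes "supp y \<subseteq> G"
  shows "incl y \<in> core"
proof -
  have "supp (incl y) \<subseteq> G \<union> N"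
    using assms h_outside_N by (fastforce simp: incl_def supp_def)
  then show ?thesis
    by (simp add: core_def incl_def boundary_diff boundary_h)
qed

lemma core_eq_incl:
  assumes "x \<in> core"
  shows "x = incl (restrict G x)"
proof (rule core_eqI[OF assms incl_in_core])
  show "supp (restrict G x) \<subseteq> G" by (auto simp: restrict_def supp_def)
qed (simp add: incl_on_G restrict_def)

lemma boundary_core:
  assumes "x \<in> core"
  shows "\<partial> x \<in> core"
proof -
  have "supp (\<partial> x) \<subseteq> gens C" by (auto simp: supp_def elim: boundary_nonzeroE)
  with assms show ?thesis
    by (auto simp: core_def boundary_boundary G_def supp_def)
qed

text \<open>
  The right-hand side lies in the core: there \<open>h\<close> cancels the \<open>P\<close>-part both of the chain and of its
  boundary. Hence it is recovered from its \<open>G\<close>-part. The formula also exhibits \<open>- h\<close> as the chain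
  homotopy from \<open>incl \<circ> proj\<close> to the identity.
\<close>

lemma incl_proj:
  assumes "supp x \<subseteq> gens C"
  shows "incl (proj x) = x - \<partial> (h x) - h (\<partial> x)"
proof -
  let ?y = "x - \<partial> (h x) - h (\<partial> x)"
  have "?y g = 0" if "g \<notin> G \<union> N" for g
  proof (cases "g \<in> P")
    case True
    moreover from True have "g \<notin> N" using disjoint by blast
    ultimately show ?thesis by (simp add: boundary_h h_outside_N)
  next
    case False
    then have "g \<notin> gens C" using that by (auto simp: G_def)
    then have "x g = 0" "\<partial> (h x) g = 0" "h (\<partial> x) g = 0"
      using assms that by (auto simp: supp_def h_outside_N elim: boundary_nonzeroE)
    then show ?thesis by simp
  qed
  then have "?y \<in> core"
    by (auto simp: core_def supp_def boundary_diff boundary_boundary boundary_h)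
  then have "?y = incl (restrict G ?y)" by (rule core_eq_incl)
  also have "restrict G ?y = proj x"
    by (auto simp: proj_def restrict_def G_def h_outside_N)
  finally show ?thesis by (rule sym)
qed

lemma proj_incl:
  assumes "supp y \<subseteq> G"
  shows "proj (incl y) = y"
proof -
  have "h (incl y) = 0"
    using incl_in_core[OF assms] disjoint by (intro h_zero_on_P) (auto simp: core_def supp_def G_def)
  then have "proj (incl y) = restrict G (incl y)"
    by (simp add: proj_def boundary_zero)
  also have "\<dots> = y"
    using assms by (auto simp: restrict_def incl_on_G supp_def fun_eq_iff)
  finally show ?thesis .
qed

lemma incl_subchains:
  assumes "y \<in> subchains C p k"
  shows "incl y \<in> subchains C p k"
proof -
  have "h (\<partial> y) \<in> subchains C p k"
  proof (cases k)
    case 0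
    then have "h (\<partial> y) = 0"
      using assms by (simp add: boundary_subchains_0 h_zero_on_P)
    then show ?thesis by (simp add: subchains_iff)
  next
    case (Suc k')
    with assms show ?thesis by (simp add: boundary_subchains h_subchains)
  qed
  with assms show ?thesis
    unfolding subchains_iff incl_def fun_diff_def by (metis diff_self)
qed

lemma proj_subchains:
  assumes "x \<in> subchains C p k"
  shows "proj x \<in> subchains C p k"
proof -
  have "\<partial> (h x) \<in> subchains C p k"
    using assms by (intro boundary_subchains h_subchains)
  with assms show ?thesis
    unfolding subchains_iff proj_def restrict_def fun_diff_def by (metis diff_self)
qed

lemma incl_add: "incl (x + y) = incl x + incl y"
  by (simp add: incl_def boundary_add h_add)

lemma incl_scale: "incl (\<lambda>g. a * x g) = (\<lambda>g. a * incl x g)"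
  by (simp add: incl_def boundary_scale h_scale fun_eq_iff right_diff_distrib)

lemma proj_add: "proj (x + y) = proj x + proj y"
  by (simp add: proj_def restrict_def boundary_add h_add fun_eq_iff)

lemma proj_scale: "proj (\<lambda>g. a * x g) = (\<lambda>g. a * proj x g)"
  by (simp add: proj_def restrict_def boundary_scale h_scale fun_eq_iff right_diff_distrib)

text \<open>
  A complex \<open>D\<close> on the remaining generators whose boundary columns come from elements of the core.
  Each such \<open>z\<close> equals \<open>incl (single c)\<close> by \<open>core_eqI\<close>; this is how the values of \<open>z\<close> are bounded.
\<close>

context
  fixes D :: "('g, 'f) bifiltered"
  assumes gens_D: "gens D = G" and gdim_D: "gdim D = gdim C" and gval_D: "gval D = gval C"
    and bd_D: "\<And>c. c \<in> G \<Longrightarrow> \<exists>z\<in>core. (\<forall>g\<in>G. z g = single c g) \<and> bd D c = restrict G (\<partial> z)"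
begin

lemma finite_G: "finite G"
  using finite_gens by (simp add: G_def)

lemma bd_D_eq:
  assumes "c \<in> G"
  shows "bd D c = restrict G (\<partial> (incl (single c)))"
proof -
  obtain z where z: "z \<in> core" "\<forall>g\<in>G. z g = single c g" "bd D c = restrict G (\<partial> z)"
    using bd_D assms by blast
  have "supp (single c :: 'g \<Rightarrow> 'f) \<subseteq> G"
    using assms by (auto simp: supp_def single_def)
  then have "z = incl (single c)"
    using z by (intro core_eqI incl_in_core) (simp_all add: incl_on_G)
  with z show ?thesis by simp
qed

lemma subchains_D_iff: "y \<in> subchains D p k \<longleftrightarrow> y \<in> subchains C p k \<and> supp y \<subseteq> G"
  by (subst mem_subchains_iff)
    (use finite_G in \<open>auto simp: gens_D gdim_D gval_D subchains_iff supp_def G_def\<close>)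

text \<open>
  The hypothesis on columns extends to chains because the combination of core elements with
  coefficients \<open>y\<close> is again the core element with \<open>G\<close>-part \<open>y\<close>.
\<close>

lemma boundary_D:
  assumes "supp y \<subseteq> G"
  shows "boundary D y = restrict G (\<partial> (incl y))"
proof -
  let ?z = "\<lambda>g. \<Sum>c\<in>G. y c * incl (single c) g"
  have sG: "incl (single c) \<in> core" if "c \<in> G" for c
    using that by (intro incl_in_core) (auto simp: supp_def single_def)
  have "?z = incl y"
  proof (rule core_eqI[OF _ incl_in_core[OF assms]])
    have "?z g = 0" if "g \<notin> G \<union> N" for g
    proof -
      have "incl (single c) g = 0" if "c \<in> G" for c
        using sG[OF that] \<open>g \<notin> G \<union> N\<close> by (auto simp: core_def supp_def)
      then show ?thesis by simp
    qed
    then show "?z \<in> core"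
      using sG by (auto simp: core_def supp_def boundary_linear_combination)
    show "?z g = incl y g" if "g \<in> G" for g
    proof -
      have "?z g = (\<Sum>c\<in>G. if c = g then y c else 0)"
        using that by (intro sum.cong) (auto simp: incl_on_G single_def)
      with that finite_G show ?thesis by (simp add: incl_on_G)
    qed
  qed
  then have "restrict G (\<partial> (incl y)) = restrict G (\<partial> ?z)" by simp
  also have "\<dots> = (\<lambda>g. \<Sum>c\<in>G. y c * bd D c g)"
    by (auto simp: boundary_linear_combination restrict_def bd_D_eq)
  finally show ?thesis by (simp add: boundary_def gens_D)
qed

lemma supp_boundary_D: "supp y \<subseteq> G \<Longrightarrow> supp (boundary D y) \<subseteq> G"
  by (auto simp: boundary_D restrict_def supp_def split: if_splits)

lemma boundary_incl:
  assumes "supp y \<subseteq> G"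
  shows "\<partial> (incl y) = incl (boundary D y)"
  using core_eq_incl[OF boundary_core[OF incl_in_core[OF assms]]] assms by (simp add: boundary_D)

lemma boundary_proj:
  assumes "supp x \<subseteq> gens C"
  shows "boundary D (proj x) = proj (\<partial> x)"
proof -
  have "supp (proj x) \<subseteq> G" by (auto simp: proj_def restrict_def supp_def)
  then have "boundary D (proj x) = restrict G (\<partial> (x - \<partial> (h x) - h (\<partial> x)))"
    using assms by (simp add: boundary_D incl_proj)
  then show ?thesis
    by (simp add: boundary_diff boundary_boundary proj_def)
qed

lemma bifiltered_complex_D: "bifiltered_complex D"
  unfolding bifiltered_complex_def
proof (intro conjI ballI allI impI)
  show "finite (gens D)" by (simp add: gens_D finite_G)
next
  fix c g assume c: "c \<in> gens D" and nz: "bd D c g \<noteq> 0"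
  then have "c \<in> G" by (simp add: gens_D)
  then have "single c \<in> subchains C (gval C c) (gdim C c)"
    by (auto simp: subchains_iff single_def G_def)
  then have incl: "incl (single c) \<in> subchains C (gval C c) (gdim C c)"
    by (rule incl_subchains)
  from nz have g: "g \<in> G" "\<partial> (incl (single c)) g \<noteq> 0"
    using \<open>c \<in> G\<close> by (auto simp: bd_D_eq restrict_def split: if_splits)
  from g(2) obtain e where "incl (single c) e \<noteq> 0" "gdim C e = Suc (gdim C g)" "gval C g \<le> gval C e"
    by (rule boundary_nonzeroE)
  with incl have "gdim C c = Suc (gdim C g)" "gval C g \<le> gval C c"
    by (fastforce simp: subchains_iff intro: order_trans)+
  with g show "g \<in> gens D" "gdim D c = Suc (gdim D g)" "gval D g \<le> gval D c"
    by (auto simp: gens_D gdim_D gval_D)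
next
  fix k and y assume "y \<in> chains D k"
  then have y: "supp y \<subseteq> G" by (auto simp: chains_def gens_D)
  have "boundary D (boundary D y) = restrict G (\<partial> (incl (boundary D y)))"
    by (rule boundary_D[OF supp_boundary_D[OF y]])
  also have "\<dots> = restrict G (\<partial> (\<partial> (incl y)))"
    by (simp only: boundary_incl[OF y])
  finally show "boundary D (boundary D y) = 0"
    by (simp add: boundary_boundary restrict_def fun_eq_iff)
qed

lemma homotopy_equivalent_D: "homotopy_equivalent D C"
proof -
  have subG: "supp y \<subseteq> G" if "y \<in> subchains D p k" for y p k
    using that by (simp add: subchains_D_iff)
  have subC: "supp x \<subseteq> gens C" if "x \<in> subchains C p k" for x p k
    using that by (auto simp: subchains_iff supp_def)
  have DC: "chain_map D C p (\<lambda>_. incl)" for p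
    by (auto simp: chain_map_def linear_map_on_def incl_add incl_scale subchains_D_iff
        incl_subchains boundary_incl)
  have "supp (proj x) \<subseteq> G" for x by (auto simp: proj_def restrict_def supp_def)
  then have CD: "chain_map C D p (\<lambda>_. proj)" for p
    by (auto simp: chain_map_def linear_map_on_def proj_add proj_scale subchains_D_iff
        proj_subchains boundary_proj[OF subC])
  have DD: "chain_homotopic D D p (\<lambda>k y. proj (incl y)) (\<lambda>k y. y)" for p
    unfolding chain_homotopic_def
  proof (intro exI conjI allI ballI)
    show "linear_map_on (subchains D p k) (subchains D p (Suc k)) (\<lambda>_. 0)" for k
      by (auto simp: linear_map_on_def subchains_D_iff subchains_iff supp_def fun_eq_iff)
    show "boundary D 0 + (if k = 0 then 0 else 0) = proj (incl y) - y"
      if "y \<in> subchains D p k" for k y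
      by (simp add: proj_incl[OF subG[OF that]]) (simp add: boundary_def fun_eq_iff)
  qed
  have CC: "chain_homotopic C C p (\<lambda>k x. incl (proj x)) (\<lambda>k x. x)" for p
    unfolding chain_homotopic_def
  proof (intro exI conjI allI ballI)
    \<comment> \<open>the minus sign is due to the order \<open>\<alpha> - \<beta>\<close>; as a scalar factor it is covered by \<open>boundary_scale\<close>\<close>
    let ?\<phi> = "\<lambda>(k::nat) x g. - 1 * h x g"
    show "linear_map_on (subchains C p k) (subchains C p (Suc k)) (?\<phi> k)" for k
    proof -
      have "?\<phi> k x \<in> subchains C p (Suc k)" if "x \<in> subchains C p k" for x
        using h_subchains[OF that] by (simp add: subchains_iff)
      then show ?thesis
        by (auto simp: linear_map_on_def h_add h_scale fun_eq_iff)
    qed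
    fix k x assume x: "x \<in> subchains C p k"
    have "(if k = 0 then 0 else ?\<phi> (k - 1) (\<partial> x)) = ?\<phi> k (\<partial> x)"
      using x by (auto simp: boundary_subchains_0 h_zero_on_P fun_eq_iff)
    then show "\<partial> (?\<phi> k x) + (if k = 0 then 0 else ?\<phi> (k - 1) (\<partial> x)) = incl (proj x) - x"
      unfolding boundary_scale incl_proj[OF subC[OF x]] by (auto simp: fun_eq_iff)
  qed
  show ?thesis
    unfolding homotopy_equivalent_def
    by (rule exI[of _ "\<lambda>_ _. incl"], rule exI[of _ "\<lambda>_ _. proj"]) (use DC CD DD CC in auto)
qed

end

end

section \<open>Triangular systems\<close>

text \<open>
  Back substitution, starting from the largest index. The relation \<open>R\<close> records which unknowns can
  occur in the solution; it is used to see that the solution stays within the dimension and the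
  filtration step of the right-hand side.
\<close>

lemma triangular_solvable:
  fixes w :: "'a \<Rightarrow> 'a \<Rightarrow> 'f::field" and idx :: "'a \<Rightarrow> 'i::linorder"
  assumes "finite S" "inj_on idx S" "reflp R" "transp R"
    and "\<And>s. s \<in> S \<Longrightarrow> w s s \<noteq> 0"
    and "\<And>s t. s \<in> S \<Longrightarrow> t \<in> S \<Longrightarrow> w s t \<noteq> 0 \<Longrightarrow> idx t \<le> idx s \<and> R t s"
  shows "\<exists>a. (\<forall>t\<in>S. (\<Sum>s\<in>S. a s * w s t) = x t) \<and>
    (\<forall>s\<in>S. a s \<noteq> 0 \<longrightarrow> (\<exists>t\<in>S. x t \<noteq> 0 \<and> R s t))"
  using assms
proof (induction S arbitrary: x rule: finite_ranking_induct[where f = idx])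
  case empty
  then show ?case by simp
next
  case (insert m S)
  show ?case
  proof (cases "m \<in> S")
    case True
    then show ?thesis using insert by (simp add: insert_absorb)
  next
    case False
    have wm: "w m m \<noteq> 0" using insert.prems by auto
    have col: "w s m = 0" if "s \<in> S" for s
      using insert.prems(5)[of s m] insert.prems(1) insert.hyps(2)[OF that] that False
      by (auto simp: inj_on_def intro: antisym)
    \<comment> \<open>equation \<open>m\<close> involves the unknown \<open>m\<close> only; solve it and substitute into the others\<close>
    let ?l = "x m / w m m"
    obtain a where a: "\<forall>t\<in>S. (\<Sum>s\<in>S. a s * w s t) = x t - ?l * w m t"
      "\<forall>s\<in>S. a s \<noteq> 0 \<longrightarrow> (\<exists>t\<in>S. x t - ?l * w m t \<noteq> 0 \<and> R s t)"
      using insert.IH[of "\<lambda>t. x t - ?l * w m t"] insert.prems by (auto simp: inj_on_insert)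
    let ?a = "a(m := ?l)"
    have split: "(\<Sum>s\<in>insert m S. ?a s * w s t) = ?l * w m t + (\<Sum>s\<in>S. a s * w s t)" for t
    proof -
      have "(\<Sum>s\<in>S. ?a s * w s t) = (\<Sum>s\<in>S. a s * w s t)"
        using False by (intro sum.cong) auto
      then show ?thesis using False insert.hyps(1) by simp
    qed
    have "(\<Sum>s\<in>insert m S. ?a s * w s t) = x t" if "t \<in> insert m S" for t
      unfolding split using that a(1) wm by (cases "t = m") (auto simp: col)
    moreover have "\<exists>t\<in>insert m S. x t \<noteq> 0 \<and> R s t" if s: "s \<in> insert m S" "?a s \<noteq> 0" for s
    proof (cases "s = m")
      case True
      with s have "x m \<noteq> 0" by auto
      with True insert.prems(2) show ?thesis by (auto dest: reflpD)
    next
      case False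
      with s a(2) obtain t where t: "t \<in> S" "x t - ?l * w m t \<noteq> 0" "R s t" by auto
      show ?thesis
      proof (cases "x t = 0")
        case True
        with t have "x m \<noteq> 0" "w m t \<noteq> 0" by auto
        then have "R t m" using insert.prems(5) t(1) by auto
        with t(3) insert.prems(3) have "R s m" by (auto dest: transpD)
        with \<open>x m \<noteq> 0\<close> show ?thesis by auto
      qed (use t in auto)
    qed
    ultimately show ?thesis by blast
  qed
qed

lemma triangular_independent:
  fixes w :: "'a \<Rightarrow> 'a \<Rightarrow> 'f::field" and idx :: "'a \<Rightarrow> 'i::linorder"
  assumes "finite S" "inj_on idx S"
    and "\<And>s. s \<in> S \<Longrightarrow> w s s \<noteq> 0"
    and "\<And>s t. s \<in> S \<Longrightarrow> t \<in> S \<Longrightarrow> w s t \<noteq> 0 \<Longrightarrow> idx t \<le> idx s"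
    and "\<And>t. t \<in> S \<Longrightarrow> (\<Sum>s\<in>S. a s * w s t) = 0"
  shows "\<forall>s\<in>S. a s = 0"
  using assms
proof (induction S rule: finite_ranking_induct[where f = idx])
  case empty
  then show ?case by simp
next
  case (insert m S)
  show ?case
  proof (cases "m \<in> S")
    case True
    then show ?thesis using insert by (simp add: insert_absorb)
  next
    case False
    have col: "w s m = 0" if "s \<in> S" for s
      using insert.prems(3)[of s m] insert.prems(1) insert.hyps(2)[OF that] that False
      by (auto simp: inj_on_def intro: antisym)
    have "a m * w m m = 0"
      using insert.prems(4)[of m] insert.hyps(1) False by (simp add: col)
    then have am: "a m = 0" using insert.prems(2) by auto
    have "\<forall>s\<in>S. a s = 0"
    proof (rule insert.IH)
      show "(\<Sum>s\<in>S. a s * w s t) = 0" if "t \<in> S" for t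
        using insert.prems(4)[of t] that insert.hyps(1) False am by simp
    qed (use insert.prems in \<open>auto simp: inj_on_insert\<close>)
    with am show ?thesis by simp
  qed
qed

section \<open>Termination and invariants of the loops\<close>

lemma exhaust_exists:
  fixes \<mu> :: "'s \<Rightarrow> nat"
  assumes "I s" and step: "\<And>s t. I s \<Longrightarrow> R s t \<Longrightarrow> I t \<and> \<mu> t < \<mu> s"
  shows "\<exists>t. exhaust R s t"
  using \<open>I s\<close>
proof (induction "\<mu> s" arbitrary: s rule: less_induct)
  case less
  show ?case
  proof (cases "\<exists>u. R s u")
    case True
    then obtain u where u: "R s u" by blast
    with less step obtain t where "exhaust R u t" by blast
    with u show ?thesis unfolding exhaust_def by (meson converse_rtranclp_into_rtranclp)
  next
    case False
    then show ?thesis by (auto simp: exhaust_def)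
  qed
qed

lemma exhaust_invariant:
  assumes "exhaust R s t" "I s" "\<And>s t. I s \<Longrightarrow> R s t \<Longrightarrow> I t"
  shows "I t"
proof -
  have "R\<^sup>*\<^sup>* s t" using assms(1) by (simp add: exhaust_def)
  then show ?thesis by induction (use assms in auto)
qed

text \<open>
  The invariant depends on the list of elements already visited; \<open>cs\<close> is the complete list, so that a
  step knows what precedes and what follows its element.
\<close>

lemma for_each_invariant:
  assumes "for_each R ys s t" "I xs s" "cs = xs @ ys"
    and "\<And>xs c ys s t. cs = xs @ c # ys \<Longrightarrow> I xs s \<Longrightarrow> R c s t \<Longrightarrow> I (xs @ [c]) t"
  shows "I cs t"
  using assms(1-3)
proof (induction arbitrary: xs)
  case (Nil s)
  then show ?case by simp
next
  case (Cons c s t cs' u)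
  then have "I (xs @ [c]) t" using assms(4) by blast
  then show ?case using Cons by simp
qed

lemma for_each_exists:
  assumes "I xs s" "cs = xs @ ys"
    and "\<And>xs c ys s t. cs = xs @ c # ys \<Longrightarrow> I xs s \<Longrightarrow> R c s t \<Longrightarrow> I (xs @ [c]) t"
    and "\<And>xs c ys s. cs = xs @ c # ys \<Longrightarrow> I xs s \<Longrightarrow> \<exists>t. R c s t"
  shows "\<exists>t. for_each R ys s t"
  using assms(1,2)
proof (induction ys arbitrary: xs s)
  case Nil
  then show ?case by (blast intro: for_each.Nil)
next
  case (Cons c ys)
  then obtain t where t: "R c s t" using assms(4) by blast
  with Cons assms(3) have "I (xs @ [c]) t" by blast
  then obtain u where "for_each R ys t u" using Cons.IH Cons.prems(2) by fastforce
  with t show ?case by (blast intro: for_each.Cons)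
qed

lemma sorted_enumeration_exists:
  assumes "finite A" "transp R" "\<And>a b. a \<in> A \<Longrightarrow> b \<in> A \<Longrightarrow> a \<noteq> b \<Longrightarrow> R a b \<or> R b a"
  shows "\<exists>xs. set xs = A \<and> sorted_wrt R xs"
  using assms(1,3)
proof induction
  case empty
  then show ?case by simp
next
  case (insert x A)
  then obtain xs where xs: "set xs = A" "sorted_wrt R xs" by auto
  let ?ys = "filter (\<lambda>a. R a x) xs @ x # filter (\<lambda>a. \<not> R a x) xs"
  have right: "R x b" if "b \<in> A" "\<not> R b x" for b
    using insert.prems[of x b] insert.hyps that by auto
  have "sorted_wrt R ?ys"
    using xs right assms(2) by (auto simp: sorted_wrt_append sorted_wrt_filter dest: transpD)
  with xs(1) show ?case by (intro exI[of _ ?ys]) auto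
qed

text \<open>
  The position in \<open>A\<close> of the largest entry of \<open>x\<close> in \<open>S\<close>, counted so that an absent entry has position
  zero. It is the termination measure of both phases: \<open>S\<close> consists of the generators with the value of
  the column in phase I and of the local generators in phase II.
\<close>

definition elimination_rank :: "'g set \<Rightarrow> ('g \<Rightarrow> 'i::linorder) \<Rightarrow> 'g set \<Rightarrow> ('g \<Rightarrow> 'f::field) \<Rightarrow> nat" where
  "elimination_rank A idx S x = card {g \<in> A. \<exists>q\<in>S. x q \<noteq> 0 \<and> idx g \<le> idx q}"

lemma elimination_rank_less:
  assumes "finite A" "p \<in> A" "p \<in> S" "x p \<noteq> 0"
    and less: "\<And>q. q \<in> S \<Longrightarrow> y q \<noteq> 0 \<Longrightarrow> idx q < idx p"
  shows "elimination_rank A idx S y < elimination_rank A idx S x"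
  unfolding elimination_rank_def
proof (rule psubset_card_mono)
  have "p \<notin> {g \<in> A. \<exists>q\<in>S. y q \<noteq> 0 \<and> idx g \<le> idx q}"
    using less by force
  moreover have "p \<in> {g \<in> A. \<exists>q\<in>S. x q \<noteq> 0 \<and> idx g \<le> idx q}"
    using assms by auto
  moreover have "{g \<in> A. \<exists>q\<in>S. y q \<noteq> 0 \<and> idx g \<le> idx q} \<subseteq> {g \<in> A. \<exists>q\<in>S. x q \<noteq> 0 \<and> idx g \<le> idx q}"
  proof (intro subsetI CollectI conjI)
    fix g assume "g \<in> {g \<in> A. \<exists>q\<in>S. y q \<noteq> 0 \<and> idx g \<le> idx q}"
    then obtain q where "g \<in> A" "q \<in> S" "y q \<noteq> 0" "idx g \<le> idx q" by blast
    with less[of q] have "idx g \<le> idx p" "g \<in> A" by simp_all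
    with assms(3,4) show "\<exists>q\<in>S. x q \<noteq> 0 \<and> idx g \<le> idx q" "g \<in> A" by blast+
  qed
  ultimately show "{g \<in> A. \<exists>q\<in>S. y q \<noteq> 0 \<and> idx g \<le> idx q} \<subset> {g \<in> A. \<exists>q\<in>S. x q \<noteq> 0 \<and> idx g \<le> idx q}"
    by blast
qed (use assms in auto)

section \<open>Local reduction\<close>

locale indexed_complex = filtered_complex C for C :: "('g, 'f::field) bifiltered" +
  fixes idx :: "'g \<Rightarrow> 'i::linorder"
  assumes index: "index_function C idx"
begin

lemma inj_idx: "inj_on idx (gens C)"
  using index by (simp add: index_function_def)

text \<open>
  Shape of the chain of which a column of phase I is the boundary. That all additional terms are
  local negative is what places the chains of global columns in the core after compression, and
  it makes the chains of negative columns a triangular basis of the span of the negative generators.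
\<close>

definition reduced_chain :: "('g \<Rightarrow> label) \<Rightarrow> 'g \<Rightarrow> ('g \<Rightarrow> 'f) \<Rightarrow> bool" where
  "reduced_chain L c z \<longleftrightarrow> c \<in> gens C \<and> z c = 1 \<and>
     (\<forall>g. z g \<noteq> 0 \<and> g \<noteq> c \<longrightarrow> g \<in> gens C \<and> L g = Local_Negative \<and>
        gdim C g = gdim C c \<and> gval C g \<le> gval C c \<and> idx g < idx c)"

lemma reduced_chain_mono:
  assumes "reduced_chain L c z" "\<And>g. L g = Local_Negative \<Longrightarrow> L' g = Local_Negative"
  shows "reduced_chain L' c z"
  using assms by (auto simp: reduced_chain_def)

lemma reduced_chain_nonzeroD:
  assumes "reduced_chain L c z" "z g \<noteq> 0"
  shows "g \<in> gens C" "gdim C g = gdim C c" "gval C g \<le> gval C c" "idx g \<le> idx c"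
    "g \<noteq> c \<Longrightarrow> L g = Local_Negative"
proof -
  have "g = c \<or> g \<noteq> c" by simp
  then show "g \<in> gens C" "gdim C g = gdim C c" "gval C g \<le> gval C c" "idx g \<le> idx c"
    "g \<noteq> c \<Longrightarrow> L g = Local_Negative"
    using assms unfolding reduced_chain_def by (auto intro: less_imp_le)
qed

lemma reduced_chain_single: "c \<in> gens C \<Longrightarrow> reduced_chain L c (single c)"
  by (auto simp: reduced_chain_def single_def)

lemma reduced_chain_boundaryD:
  assumes "reduced_chain L c z" "\<partial> z g \<noteq> 0"
  shows "g \<in> gens C" "gdim C c = Suc (gdim C g)" "gval C g \<le> gval C c"
proof -
  obtain e where e: "z e \<noteq> 0" "g \<in> gens C" "gdim C e = Suc (gdim C g)" "gval C g \<le> gval C e"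
    using assms(2) by (rule boundary_nonzeroE)
  note reduced_chain_nonzeroD[OF assms(1) e(1)]
  with e show "g \<in> gens C" "gdim C c = Suc (gdim C g)" "gval C g \<le> gval C c"
    by (auto intro: order_trans)
qed

lemma local_pivot_cong: "B c = B' c \<Longrightarrow> local_pivot C idx B c p \<longleftrightarrow> local_pivot C idx B' c p"
  by (simp add: local_pivot_def)

text \<open>
  The local pivot dominates the entries of the same value by definition, and the entries of strictly
  smaller value because the index is consistent with the values.
\<close>

lemma local_pivot_maximal:
  assumes "reduced_chain L n z" "B n = \<partial> z" "local_pivot C idx B n p" "B n g \<noteq> 0"
  shows "idx g \<le> idx p"
proof (cases "gval C g = gval C n")
  case True
  with assms show ?thesis by (simp add: local_pivot_def)
next
  case False
  have "\<partial> z g \<noteq> 0" "\<partial> z p \<noteq> 0" "gval C p = gval C n"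
    using assms by (auto simp: local_pivot_def)
  with assms(1) have "g \<in> gens C" "p \<in> gens C" "gval C g \<le> gval C p"
    by (auto dest: reduced_chain_boundaryD)
  with False \<open>gval C p = gval C n\<close> index have "idx g < idx p"
    by (auto simp: index_function_def)
  then show ?thesis by simp
qed

text \<open>
  State of phase I when the columns in \<open>T\<close> have been traversed. The last three clauses say that
  \<open>local_pivot\<close> is a bijection between negative and positive columns. A positive column may lie outside \<open>T\<close>:
  it is labeled while the dimension above is processed.
\<close>

definition reduction_invariant :: "'g set \<Rightarrow> ('g \<Rightarrow> 'g \<Rightarrow> 'f) \<Rightarrow> ('g \<Rightarrow> label) \<Rightarrow> bool" where
  "reduction_invariant T B L \<longleftrightarrow>
     (\<forall>c. L c \<noteq> Unlabeled \<longrightarrow> c \<in> gens C) \<and>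
     (\<forall>c\<in>T. L c \<noteq> Unlabeled) \<and>
     (\<forall>c. L c = Global \<or> L c = Local_Negative \<longrightarrow> c \<in> T \<and> (\<exists>z. reduced_chain L c z \<and> B c = \<partial> z)) \<and>
     (\<forall>c. L c \<noteq> Global \<and> L c \<noteq> Local_Negative \<longrightarrow> B c = bd C c) \<and>
     (\<forall>n. L n = Local_Negative \<longrightarrow> (\<exists>p. L p = Local_Positive \<and> local_pivot C idx B n p)) \<and>
     (\<forall>p. L p = Local_Positive \<longrightarrow> (\<exists>n. L n = Local_Negative \<and> local_pivot C idx B n p)) \<and>
     (\<forall>n n' p. L n = Local_Negative \<and> L n' = Local_Negative \<and>
        local_pivot C idx B n p \<and> local_pivot C idx B n' p \<longrightarrow> n = n')"

lemma reduction_invariantD: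
  assumes "reduction_invariant T B L"
  shows labeled_in_gens: "L c \<noteq> Unlabeled \<Longrightarrow> c \<in> gens C"
    and processed_labeled: "c \<in> T \<Longrightarrow> L c \<noteq> Unlabeled"
    and reduced_processed: "L c = Global \<or> L c = Local_Negative \<Longrightarrow> c \<in> T"
    and reduced_has_chain: "L c = Global \<or> L c = Local_Negative \<Longrightarrow> \<exists>z. reduced_chain L c z \<and> B c = \<partial> z"
    and unreduced_boundary: "L c \<noteq> Global \<Longrightarrow> L c \<noteq> Local_Negative \<Longrightarrow> B c = bd C c"
    and negative_has_pivot: "L c = Local_Negative \<Longrightarrow> \<exists>p. L p = Local_Positive \<and> local_pivot C idx B c p"
    and positive_is_pivot: "L c = Local_Positive \<Longrightarrow> \<exists>n. L n = Local_Negative \<and> local_pivot C idx B n c"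
    and pivots_distinct: "L n = Local_Negative \<Longrightarrow> L n' = Local_Negative \<Longrightarrow>
      local_pivot C idx B n p \<Longrightarrow> local_pivot C idx B n' p \<Longrightarrow> n = n'"
  using assms unfolding reduction_invariant_def by blast+

text \<open>
  Invariant of the inner loop of phase I at column \<open>c\<close>, starting from the boundaries \<open>B\<^sub>0\<close>.
\<close>

definition column_reduced :: "('g \<Rightarrow> label) \<Rightarrow> 'g \<Rightarrow> ('g \<Rightarrow> 'g \<Rightarrow> 'f) \<Rightarrow> ('g \<Rightarrow> 'g \<Rightarrow> 'f) \<Rightarrow> bool" where
  "column_reduced L c B\<^sub>0 B \<longleftrightarrow> (\<forall>d. d \<noteq> c \<longrightarrow> B d = B\<^sub>0 d) \<and> (\<exists>z. reduced_chain L c z \<and> B c = \<partial> z)"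

lemma reduction_step_invariant:
  assumes inv: "reduction_invariant T B\<^sub>0 L" and red: "column_reduced L c B\<^sub>0 B"
    and step: "reduction_step C idx L c B B'"
  shows "column_reduced L c B\<^sub>0 B' \<and>
    elimination_rank (gens C) idx {g. gval C g = gval C c} (B' c) <
    elimination_rank (gens C) idx {g. gval C g = gval C c} (B c)"
  using step
proof cases
  case (1 p c' lam)
  note st = this
  have "c' \<noteq> c" using st by auto
  obtain z where z: "reduced_chain L c z" "B c = \<partial> z" and others: "\<And>d. d \<noteq> c \<Longrightarrow> B d = B\<^sub>0 d"
    using red by (auto simp: column_reduced_def)
  obtain z' where z': "reduced_chain L c' z'" "B c' = \<partial> z'"
    using reduced_has_chain[OF inv, of c'] st others[OF \<open>c' \<noteq> c\<close>] by auto
  let ?z = "z + (\<lambda>g. lam * z' g)"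
  have val: "gval C p = gval C c" "gval C c' = gval C c"
    using st by (auto simp: local_pivot_def)
  have B'c: "B' c = (\<lambda>g. B c g + lam * B c' g)"
    using st by (simp add: column_addition_def)
  have "B' c = \<partial> ?z"
    unfolding B'c z(2) z'(2) boundary_add boundary_scale by (simp add: plus_fun_def)
  moreover have "reduced_chain L c ?z"
  proof -
    have "z' c = 0" using reduced_chain_nonzeroD(4)[OF z'(1), of c] st by fastforce
    moreover have "L g = Local_Negative" "idx g < idx c" if "z' g \<noteq> 0" for g
      using reduced_chain_nonzeroD(4,5)[OF z'(1) that] st by (auto split: if_splits)
    moreover have "g \<in> gens C" "gdim C g = gdim C c" "gval C g \<le> gval C c" if "z' g \<noteq> 0" for g
      using reduced_chain_nonzeroD[OF z'(1) that] st val by auto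
    ultimately show ?thesis
      using z(1) unfolding reduced_chain_def
      by (metis (no_types, lifting) add.right_neutral add_0 mult_zero_right plus_fun_apply)
  qed
  moreover have "B' d = B\<^sub>0 d" if "d \<noteq> c" for d
    using st others that by (simp add: column_addition_def)
  ultimately have "column_reduced L c B\<^sub>0 B'"
    unfolding column_reduced_def by blast
  moreover have "elimination_rank (gens C) idx {g. gval C g = gval C c} (B' c) <
    elimination_rank (gens C) idx {g. gval C g = gval C c} (B c)"
  proof (rule elimination_rank_less[where p = p])
    have p: "B c p \<noteq> 0" using st by (simp add: local_pivot_def)
    then show "B c p \<noteq> 0" .
    show "p \<in> gens C" using reduced_chain_boundaryD(1) z p by auto
    fix q assume q: "q \<in> {g. gval C g = gval C c}" "B' c q \<noteq> 0"
    then have "B c q \<noteq> 0 \<or> B c' q \<noteq> 0" by (auto simp: B'c)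
    then have "q \<in> gens C" "idx q \<le> idx p"
      using z z' st q(1) val by (auto simp: local_pivot_def dest: reduced_chain_boundaryD(1))
    moreover have "B' c p = 0" unfolding B'c using st by simp
    then have "q \<noteq> p" using q(2) by auto
    ultimately show "idx q < idx p"
      using inj_idx \<open>p \<in> gens C\<close> by (metis inj_onD order_le_less)
  qed (use finite_gens val in auto)
  ultimately show ?thesis by blast
qed

lemma column_reduced_init:
  assumes "reduction_invariant T B L" "c \<in> gens C" "L c = Unlabeled"
  shows "column_reduced L c B B"
  unfolding column_reduced_def
proof (intro conjI exI[of _ "single c"])
  show "B c = \<partial> (single c)"
    using assms by (simp add: boundary_single unreduced_boundary)
qed (simp_all add: reduced_chain_single assms(2))

lemma exhausted_column_reduced:
  assumes "reduction_invariant T B L" "c \<in> gens C" "L c = Unlabeled"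
    and ex: "exhaust (reduction_step C idx L c) B B'"
  shows "column_reduced L c B B'"
  by (rule exhaust_invariant[where I = "column_reduced L c B", OF ex])
    (use column_reduced_init[OF assms(1-3)] reduction_step_invariant[OF assms(1)] in blast)+

lemma reduce_column_exists:
  assumes inv: "reduction_invariant T B L" and c: "c \<in> gens C"
  shows "\<exists>t. reduce_column C idx c (B, L) t"
proof (cases "L c = Unlabeled")
  case True
  have "\<exists>B'. exhaust (reduction_step C idx L c) B B'"
  proof (rule exhaust_exists[where I = "column_reduced L c B"
        and \<mu> = "\<lambda>B. elimination_rank (gens C) idx {g. gval C g = gval C c} (B c)"])
    show "column_reduced L c B B" by (rule column_reduced_init[OF inv c True])
  qed (rule reduction_step_invariant[OF inv])
  with True show ?thesis by (meson reduce_column.global reduce_column.local)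
next
  case False
  then show ?thesis by (blast intro: reduce_column.labeled)
qed

definition precedes :: "'g \<Rightarrow> 'g \<Rightarrow> bool" where
  "precedes a b \<longleftrightarrow> gdim C a > gdim C b \<or> gdim C a = gdim C b \<and> idx a < idx b"

text \<open>
  The pivot \<open>p\<close> of a column \<open>c\<close> that becomes negative has dimension one less than \<open>c\<close>. Therefore it has not
  been traversed, and marking it positive destroys no other label. It is not the pivot of an earlier
  negative column, for otherwise the inner loop could go on.
\<close>

lemma reduce_column_invariant:
  assumes inv: "reduction_invariant T B L" and c: "c \<in> gens C"
    and prec: "\<And>t. t \<in> T \<Longrightarrow> precedes t c"
    and step: "reduce_column C idx c (B, L) (B', L')"
  shows "reduction_invariant (insert c T) B' L'"
  using step
proof cases
  case labeled
  then show ?thesis using inv unfolding reduction_invariant_def by blast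
next
  case global
  have red: "column_reduced L c B B'"
    by (rule exhausted_column_reduced[OF inv c global(2,3)])
  then obtain z where z: "reduced_chain L c z" "B' c = \<partial> z" and others: "\<And>d. d \<noteq> c \<Longrightarrow> B' d = B d"
    by (auto simp: column_reduced_def)
  have neg: "L' g = Local_Negative \<longleftrightarrow> L g = Local_Negative" for g
    using global by auto
  have pos: "L' g = Local_Positive \<longleftrightarrow> L g = Local_Positive" for g
    using global by auto
  have L': "L' c = Global" "\<And>d. d \<noteq> c \<Longrightarrow> L' d = L d" using global by auto
  have pivot: "local_pivot C idx B' n p \<longleftrightarrow> local_pivot C idx B n p" if "L n = Local_Negative" for n p
    using that global by (intro local_pivot_cong others) auto
  have chain: "reduced_chain L' d z" if "reduced_chain L d z" for d z
    using that by (rule reduced_chain_mono) (simp add: neg)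
  show ?thesis
    unfolding reduction_invariant_def neg pos
  proof (intro conjI allI impI ballI)
    show "d \<in> gens C" if "L' d \<noteq> Unlabeled" for d
      using that c labeled_in_gens[OF inv] L' by (cases "d = c") auto
    show "L' d \<noteq> Unlabeled" if "d \<in> insert c T" for d
      using that processed_labeled[OF inv] L' by (cases "d = c") auto
    fix d assume d: "L' d = Global \<or> L d = Local_Negative"
    show "d \<in> insert c T"
      using d reduced_processed[OF inv, of d] L' by (cases "d = c") auto
    show "\<exists>z. reduced_chain L' d z \<and> B' d = \<partial> z"
    proof (cases "d = c")
      case True
      with z chain show ?thesis by blast
    next
      case False
      then show ?thesis using d reduced_has_chain[OF inv, of d] L' chain others by force
    qed
  next
    show "B' d = bd C d" if "L' d \<noteq> Global \<and> L d \<noteq> Local_Negative" for d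
      using that L' unreduced_boundary[OF inv, of d] others by (cases "d = c") auto
    show "\<exists>p. L p = Local_Positive \<and> local_pivot C idx B' n p" if "L n = Local_Negative" for n
      using negative_has_pivot[OF inv that] pivot[OF that] by blast
    show "\<exists>n. L n = Local_Negative \<and> local_pivot C idx B' n p" if "L p = Local_Positive" for p
      using positive_is_pivot[OF inv that] pivot by blast
    show "n = n'" if "L n = Local_Negative \<and> L n' = Local_Negative \<and>
      local_pivot C idx B' n p \<and> local_pivot C idx B' n' p" for n n' p
      using that pivots_distinct[OF inv, of n n' p] pivot by blast
  qed
next
  case (local p)
  have red: "column_reduced L c B B'"
    by (rule exhausted_column_reduced[OF inv c local(2,3)])
  then obtain z where z: "reduced_chain L c z" "B' c = \<partial> z" and others: "\<And>d. d \<noteq> c \<Longrightarrow> B' d = B d"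
    by (auto simp: column_reduced_def)
  have "\<partial> z p \<noteq> 0" using local z by (auto simp: local_pivot_def)
  with z(1) have p: "p \<in> gens C" "gdim C c = Suc (gdim C p)"
    using reduced_chain_boundaryD by blast+
  then have "p \<notin> T" using prec[of p] by (auto simp: precedes_def)
  then have Lp: "L p \<noteq> Global" "L p \<noteq> Local_Negative"
    using reduced_processed[OF inv, of p] by auto
  have "p \<noteq> c" using p by auto
  have L': "L' c = Local_Negative" "L' p = Local_Positive"
    "\<And>d. d \<noteq> c \<Longrightarrow> d \<noteq> p \<Longrightarrow> L' d = L d"
    using local \<open>p \<noteq> c\<close> by auto
  have glob: "L' g = Global \<longleftrightarrow> L g = Global" for g
    using L' Lp local(2) by (cases "g = c"; cases "g = p") auto
  have neg: "L' g = Local_Negative \<longleftrightarrow> g = c \<or> L g = Local_Negative" for g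
    using L' Lp by (cases "g = c"; cases "g = p") auto
  have pos: "L' g = Local_Positive \<longleftrightarrow> g = p \<or> L g = Local_Positive" for g
    using L' local(2) by (cases "g = c"; cases "g = p") auto
  have neq: "n \<noteq> c" if "L n = Local_Negative" for n
    using that local(2) by auto
  have pivot: "local_pivot C idx B' n q \<longleftrightarrow> local_pivot C idx B n q" if "L n = Local_Negative" for n q
    using neq[OF that] by (intro local_pivot_cong others)
  have chain: "reduced_chain L' d z" if "reduced_chain L d z" for d z
    using that by (rule reduced_chain_mono) (simp add: neg)
  \<comment> \<open>an earlier negative column with the same pivot would allow another addition to \<open>c\<close>\<close>
  have new: False
    if n: "L n = Local_Negative" and q: "local_pivot C idx B' n q" "local_pivot C idx B' c q" for n q
  proof -
    obtain z' where z': "reduced_chain L n z'" "B n = \<partial> z'"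
      using reduced_has_chain[OF inv] n by blast
    have nz: "B' n q \<noteq> 0" "B' c q \<noteq> 0" using q by (auto simp: local_pivot_def)
    then have "gdim C n = Suc (gdim C q)" "gdim C c = Suc (gdim C q)"
      using z z' others[OF neq[OF n]] by (auto dest: reduced_chain_boundaryD)
    then have dim: "gdim C n = gdim C c" by simp
    moreover have "precedes n c" using prec reduced_processed[OF inv, of n] n by blast
    ultimately have "idx n < idx c" by (simp add: precedes_def)
    moreover have "B' c q + (- B' c q / B' n q) * B' n q = 0" using nz by simp
    ultimately have "reduction_step C idx L c B' (column_addition c (- B' c q / B' n q) n B')"
      using q n dim labeled_in_gens[OF inv, of n] by (intro reduction_step.intros) auto
    with local(3) show False by (auto simp: exhaust_def)
  qed
  show ?thesis
    unfolding reduction_invariant_def neg pos glob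
  proof (intro conjI allI impI ballI)
    show "d \<in> gens C" if "L' d \<noteq> Unlabeled" for d
      using that c p labeled_in_gens[OF inv, of d] L' by (cases "d = c"; cases "d = p") auto
    show "L' d \<noteq> Unlabeled" if "d \<in> insert c T" for d
      using that processed_labeled[OF inv, of d] L' by (cases "d = c"; cases "d = p") auto
    fix d assume d: "L d = Global \<or> d = c \<or> L d = Local_Negative"
    show "d \<in> insert c T"
      using d reduced_processed[OF inv, of d] by auto
    show "\<exists>z. reduced_chain L' d z \<and> B' d = \<partial> z"
    proof (cases "d = c")
      case True
      with z chain show ?thesis by blast
    next
      case False
      then show ?thesis using d reduced_has_chain[OF inv, of d] chain others by force
    qed
  next
    show "B' d = bd C d" if "L d \<noteq> Global \<and> \<not> (d = c \<or> L d = Local_Negative)" for d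
      using that unreduced_boundary[OF inv, of d] others by auto
    show "\<exists>q. (q = p \<or> L q = Local_Positive) \<and> local_pivot C idx B' n q"
      if "n = c \<or> L n = Local_Negative" for n
      using that local(4) negative_has_pivot[OF inv, of n] pivot by blast
    show "\<exists>n. (n = c \<or> L n = Local_Negative) \<and> local_pivot C idx B' n q"
      if "q = p \<or> L q = Local_Positive" for q
      using that local(4) positive_is_pivot[OF inv, of q] pivot by blast
    show "n = n'" if "(n = c \<or> L n = Local_Negative) \<and> (n' = c \<or> L n' = Local_Negative) \<and>
      local_pivot C idx B' n q \<and> local_pivot C idx B' n' q" for n n' q
      using that pivots_distinct[OF inv, of n n' q] pivot new by blast
  qed
qed

lemma reduction_invariant_init: "reduction_invariant {} (bd C) (\<lambda>_. Unlabeled)"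
  by (simp add: reduction_invariant_def)

lemma reduce_column_prefix_invariant:
  assumes cs: "set cs = gens C" "sorted_wrt precedes cs" "cs = xs @ c # ys"
    and "reduction_invariant (set xs) (fst s) (snd s)" "reduce_column C idx c s t"
  shows "reduction_invariant (set (xs @ [c])) (fst t) (snd t)"
proof -
  have "c \<in> gens C" "\<And>t. t \<in> set xs \<Longrightarrow> precedes t c"
    using cs by (auto simp: sorted_wrt_append)
  with reduce_column_invariant[of "set xs" "fst s" "snd s" c "fst t" "snd t"] assms(4,5)
  show ?thesis by simp
qed

lemma phase_I_invariant:
  assumes "phase_I C idx (B, L)"
  shows "reduction_invariant (gens C) B L"
proof -
  obtain cs where cs: "set cs = gens C" "sorted_wrt precedes cs"
    "for_each (reduce_column C idx) cs (bd C, \<lambda>_. Unlabeled) (B, L)"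
    using assms by (auto simp: phase_I_def precedes_def[abs_def])
  have "reduction_invariant (set cs) (fst (B, L)) (snd (B, L))"
    by (rule for_each_invariant[OF cs(3), where xs = "[]"])
      (use reduction_invariant_init reduce_column_prefix_invariant[OF cs(1,2)] in auto)
  with cs show ?thesis by simp
qed

lemma phase_I_exists: "\<exists>B L. phase_I C idx (B, L)"
proof -
  have "\<exists>cs. set cs = gens C \<and> sorted_wrt precedes cs"
  proof (rule sorted_enumeration_exists[OF finite_gens])
    show "transp precedes" by (rule transpI) (auto simp: precedes_def)
    show "precedes a b \<or> precedes b a" if "a \<in> gens C" "b \<in> gens C" "a \<noteq> b" for a b
      using that inj_idx by (auto simp: precedes_def inj_on_def) (meson linorder_neqE)
  qed
  then obtain cs where cs: "set cs = gens C" "sorted_wrt precedes cs" by blast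
  have "\<exists>t. for_each (reduce_column C idx) cs (bd C, \<lambda>_. Unlabeled) t"
  proof (rule for_each_exists[where xs = "[]" and cs = cs
        and I = "\<lambda>xs s. reduction_invariant (set xs) (fst s) (snd s)"])
    show "\<exists>t. reduce_column C idx c s t"
      if "cs = xs @ c # ys" "reduction_invariant (set xs) (fst s) (snd s)" for xs c ys s
      using reduce_column_exists[OF that(2), of c] that(1) cs(1) by auto
  qed (use reduction_invariant_init reduce_column_prefix_invariant[OF cs] in auto)
  with cs show ?thesis by (auto simp: phase_I_def precedes_def[abs_def])
qed

section \<open>The local block is invertible\<close>

text \<open>
  In what follows, \<open>A\<close> and \<open>L\<close> are the boundaries and labels at the end of phase I.
\<close>

context
  fixes A :: "'g \<Rightarrow> 'g \<Rightarrow> 'f" and L :: "'g \<Rightarrow> label"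
  assumes inv: "reduction_invariant (gens C) A L"
begin

text \<open>
  Two triangular systems are combined. The chains \<open>z n\<close> of the negative columns form a basis of the
  span of \<open>N\<close>, as \<open>z n\<close> has the leading term \<open>n\<close>. With respect to this basis, and with
  each negative column \<open>\<nu> p\<close> numbered by its pivot \<open>p\<close>, the block from \<open>N\<close> to \<open>P\<close> is triangular with
  the pivots on the diagonal.
\<close>

lemma cancellable_local_pairs:
  "cancellable C {n. L n = Local_Negative} {p. L p = Local_Positive}" (is "cancellable C ?N ?P")
proof
  show N_gens: "?N \<subseteq> gens C" using labeled_in_gens[OF inv] by auto
  have P_gens: "?P \<subseteq> gens C" using labeled_in_gens[OF inv] by auto
  show "?N \<inter> ?P = {}" by auto
  have fin: "finite ?N" "finite ?P"
    using N_gens P_gens finite_gens by (auto intro: finite_subset)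
  have inj: "inj_on idx ?N" "inj_on idx ?P"
    using N_gens P_gens inj_idx by (auto intro: inj_on_subset)
  obtain z where z: "\<And>n. n \<in> ?N \<Longrightarrow> reduced_chain L n (z n)" "\<And>n. n \<in> ?N \<Longrightarrow> A n = \<partial> (z n)"
    using reduced_has_chain[OF inv] by (simp, metis)
  obtain \<nu> where \<nu>: "\<And>p. p \<in> ?P \<Longrightarrow> \<nu> p \<in> ?N" "\<And>p. p \<in> ?P \<Longrightarrow> local_pivot C idx A (\<nu> p) p"
    using positive_is_pivot[OF inv] by (simp, metis)
  let ?w = "\<lambda>p. \<partial> (z (\<nu> p))"
  have diag: "?w p p \<noteq> 0" if "p \<in> ?P" for p
    using \<nu>[OF that] z(2)[of "\<nu> p"] by (simp add: local_pivot_def)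
  have pair: "gdim C (\<nu> p) = Suc (gdim C p)" "gval C (\<nu> p) = gval C p" if "p \<in> ?P" for p
    using \<nu>[OF that] diag[OF that] reduced_chain_boundaryD(2)[OF z(1)]
    by (auto simp: local_pivot_def)
  have tri: "idx t \<le> idx s" "gdim C t = gdim C s" "gval C t \<le> gval C s"
    if "s \<in> ?P" "?w s t \<noteq> 0" for s t
  proof -
    note n = \<nu>[OF that(1)]
    show "idx t \<le> idx s"
      using local_pivot_maximal[OF z[OF n(1)] n(2)] that(2) z(2)[OF n(1)] by simp
    show "gdim C t = gdim C s" "gval C t \<le> gval C s"
      using reduced_chain_boundaryD[OF z(1)[OF n(1)] that(2)] pair[OF that(1)] by auto
  qed
  show "\<exists>u. supp u \<subseteq> ?N \<and> (\<forall>p\<in>?P. \<partial> u p = x p) \<and> (\<forall>n. u n \<noteq> 0 \<longrightarrow>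
    (\<exists>p\<in>?P. x p \<noteq> 0 \<and> gdim C n = Suc (gdim C p) \<and> gval C n \<le> gval C p))" for x
  proof -
    let ?R = "\<lambda>s t. gdim C s = gdim C t \<and> gval C s \<le> gval C t"
    have R: "reflp ?R" "transp ?R" by (auto simp: reflp_def transp_def intro: order_trans)
    have "\<exists>a. (\<forall>t\<in>?P. (\<Sum>s\<in>?P. a s * ?w s t) = x t) \<and>
        (\<forall>s\<in>?P. a s \<noteq> 0 \<longrightarrow> (\<exists>t\<in>?P. x t \<noteq> 0 \<and> ?R s t))"
      by (rule triangular_solvable[OF fin(2) inj(2) R diag]) (simp_all only: tri simp_thms)
    then obtain a where a: "\<forall>t\<in>?P. (\<Sum>s\<in>?P. a s * ?w s t) = x t"
      "\<forall>s\<in>?P. a s \<noteq> 0 \<longrightarrow> (\<exists>t\<in>?P. x t \<noteq> 0 \<and> gdim C s = gdim C t \<and> gval C s \<le> gval C t)"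
      by blast
    let ?u = "\<lambda>g. \<Sum>s\<in>?P. a s * z (\<nu> s) g"
    have u_P: "\<forall>p\<in>?P. \<partial> ?u p = x p"
      using a(1) by (simp add: boundary_linear_combination)
    have u_n: "n \<in> ?N \<and> (\<exists>p\<in>?P. x p \<noteq> 0 \<and> gdim C n = Suc (gdim C p) \<and> gval C n \<le> gval C p)"
      if n: "?u n \<noteq> 0" for n
    proof -
      obtain s where "s \<in> ?P" "a s * z (\<nu> s) n \<noteq> 0"
        using n by (rule sum.not_neutral_contains_not_neutral)
      then have s: "s \<in> ?P" "a s \<noteq> 0" "z (\<nu> s) n \<noteq> 0" by simp_all
      note D = reduced_chain_nonzeroD[OF z(1)[OF \<nu>(1)[OF s(1)]] s(3)]
      have "n \<in> ?N" using D(5) \<nu>(1)[OF s(1)] by (cases "n = \<nu> s") auto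
      moreover obtain t where t: "t \<in> ?P" "x t \<noteq> 0" "gdim C s = gdim C t" "gval C s \<le> gval C t"
        using a(2) s by blast
      moreover have "gdim C n = Suc (gdim C t)"
        using D(2) pair(1)[OF s(1)] t(3) by simp
      moreover have "gval C n \<le> gval C t"
        using D(3) t(4) unfolding pair(2)[OF s(1)] by (rule order_trans)
      ultimately show ?thesis by blast
    qed
    have "supp ?u \<subseteq> ?N" unfolding supp_def using u_n by blast
    with u_P u_n show ?thesis by (intro exI[of _ ?u] conjI allI impI) blast+
  qed
  show "u = 0" if u: "supp u \<subseteq> ?N" "\<And>p. p \<in> ?P \<Longrightarrow> \<partial> u p = 0" for u
  proof -
    have zN: "n \<in> ?N" if "s \<in> ?N" "z s n \<noteq> 0" for s n
      using reduced_chain_nonzeroD(5)[OF z(1)[OF that(1)] that(2)] that(1) by (cases "n = s") auto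
    have "z s s \<noteq> 0" if "s \<in> ?N" for s
      using z(1)[OF that] by (simp add: reduced_chain_def)
    then obtain a where a: "\<forall>t\<in>?N. (\<Sum>s\<in>?N. a s * z s t) = u t"
      using triangular_solvable[OF fin(1) inj(1), of "\<lambda>_ _. True" z u]
        reduced_chain_nonzeroD(4)[OF z(1)] by (auto simp: reflp_def transp_def)
    have ua: "u = (\<lambda>g. \<Sum>s\<in>?N. a s * z s g)"
    proof
      fix g
      show "u g = (\<Sum>s\<in>?N. a s * z s g)"
      proof (cases "g \<in> ?N")
        case True
        with a show ?thesis by simp
      next
        case False
        then have "u g = 0" "\<And>s. s \<in> ?N \<Longrightarrow> z s g = 0" using u(1) zN by (auto simp: supp_def)
        then show ?thesis by simp
      qed
    qed
    have "bij_betw \<nu> ?P ?N"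
    proof (rule bij_betwI')
      fix p p' assume p: "p \<in> ?P" "p' \<in> ?P"
      show "\<nu> p = \<nu> p' \<longleftrightarrow> p = p'"
      proof
        assume "\<nu> p = \<nu> p'"
        then have "idx p = idx p'"
          using \<nu>(2)[OF p(1)] \<nu>(2)[OF p(2)] by (auto simp: local_pivot_def intro: antisym)
        with p inj(2) show "p = p'" by (auto dest: inj_onD)
      qed simp
    next
      fix n assume "n \<in> ?N"
      then obtain p where "p \<in> ?P" "local_pivot C idx A n p"
        using negative_has_pivot[OF inv] by blast
      with \<nu> \<open>n \<in> ?N\<close> show "\<exists>p\<in>?P. n = \<nu> p"
        using pivots_distinct[OF inv] by blast
    qed (use \<nu> in auto)
    then have "(\<Sum>s\<in>?P. a (\<nu> s) * ?w s t) = (\<Sum>s\<in>?N. a s * \<partial> (z s) t)" for t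
      by (rule sum.reindex_bij_betw)
    then have "(\<Sum>s\<in>?P. a (\<nu> s) * ?w s t) = 0" if "t \<in> ?P" for t
      using u(2)[OF that] by (simp add: ua boundary_linear_combination)
    then have "\<forall>s\<in>?P. a (\<nu> s) = 0"
      by (intro triangular_independent[OF fin(2) inj(2) diag tri(1)]) auto
    moreover have "?N = \<nu> ` ?P" using \<open>bij_betw \<nu> ?P ?N\<close> by (simp add: bij_betw_def)
    ultimately have "\<forall>s\<in>?N. a s = 0" by (simp only: ball_simps)
    then show "u = 0" by (simp add: ua fun_eq_iff)
  qed
qed

section \<open>Compression\<close>

text \<open>
  Shape of the chain of which a column of phase II is the boundary, up to negative entries. Once the
  boundary has no positive part, the chain lies in the core and is determined by its global part \<open>c\<close>.
\<close>

definition compressed_chain :: "'g \<Rightarrow> ('g \<Rightarrow> 'f) \<Rightarrow> bool" where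
  "compressed_chain c z \<longleftrightarrow> z c = 1 \<and> (\<forall>g. z g \<noteq> 0 \<and> g \<noteq> c \<longrightarrow> L g = Local_Negative)"

text \<open>
  Invariant of the loop of phase II at column \<open>c\<close>. The entries at negative generators carry no
  information, because some of them have been erased.
\<close>

definition column_compressed :: "'g \<Rightarrow> ('g \<Rightarrow> 'g \<Rightarrow> 'f) \<Rightarrow> ('g \<Rightarrow> 'g \<Rightarrow> 'f) \<Rightarrow> bool" where
  "column_compressed c B\<^sub>0 B \<longleftrightarrow> (\<forall>d. d \<noteq> c \<longrightarrow> B d = B\<^sub>0 d) \<and>
     (\<exists>z. compressed_chain c z \<and> (\<forall>g. L g \<noteq> Local_Negative \<longrightarrow> B c g = \<partial> z g)) \<and>
     (\<forall>g. B c g \<noteq> 0 \<longrightarrow> g \<in> gens C \<and> gdim C c = Suc (gdim C g))"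

lemma column_compressed_init:
  assumes "L c = Global" "B c = A c"
  shows "column_compressed c B B"
proof -
  obtain z where z: "reduced_chain L c z" "A c = \<partial> z"
    using reduced_has_chain[OF inv] assms by blast
  then have "compressed_chain c z" by (auto simp: reduced_chain_def compressed_chain_def)
  with z assms(2) show ?thesis
    using reduced_chain_boundaryD[OF z(1)] by (auto simp: column_compressed_def)
qed

lemma compression_step_invariant:
  assumes c: "L c = Global" and neg: "\<And>n. L n = Local_Negative \<Longrightarrow> B\<^sub>0 n = A n"
    and red: "column_compressed c B\<^sub>0 B" and step: "compression_step C idx L c B B'"
  shows "column_compressed c B\<^sub>0 B' \<and>
    elimination_rank (gens C) idx {g. is_local (L g)} (B' c) <
    elimination_rank (gens C) idx {g. is_local (L g)} (B c)"
proof -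
  obtain z where z: "compressed_chain c z" "\<And>g. L g \<noteq> Local_Negative \<Longrightarrow> B c g = \<partial> z g"
    and others: "\<And>d. d \<noteq> c \<Longrightarrow> B d = B\<^sub>0 d"
    and supp: "\<And>g. B c g \<noteq> 0 \<Longrightarrow> g \<in> gens C" "\<And>g. B c g \<noteq> 0 \<Longrightarrow> gdim C c = Suc (gdim C g)"
    using red by (auto simp: column_compressed_def)
  from step show ?thesis
  proof cases
    case (negative c')
    have "column_compressed c B\<^sub>0 B'"
      unfolding column_compressed_def
    proof (intro conjI exI[of _ z])
      show "\<forall>g. L g \<noteq> Local_Negative \<longrightarrow> B' c g = \<partial> z g" using negative z by auto
    qed (use negative z others supp in auto)
    moreover have "elimination_rank (gens C) idx {g. is_local (L g)} (B' c) <
      elimination_rank (gens C) idx {g. is_local (L g)} (B c)"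
    proof (rule elimination_rank_less[where p = c'])
      show c': "B c c' \<noteq> 0" "c' \<in> {g. is_local (L g)}" "c' \<in> gens C"
        using negative supp by (auto simp: max_local_def)
      fix q assume "q \<in> {g. is_local (L g)}" "B' c q \<noteq> 0"
      then have "q \<noteq> c'" "idx q \<le> idx c'" "q \<in> gens C"
        using negative supp by (auto simp: max_local_def split: if_splits)
      with c'(3) inj_idx show "idx q < idx c'" by (metis inj_onD order_le_less)
    qed (rule finite_gens)
    ultimately show ?thesis by blast
  next
    case (positive c' c'' lam)
    have "c'' \<noteq> c" using positive c by auto
    obtain z'' where z'': "reduced_chain L c'' z''" "A c'' = \<partial> z''"
      using reduced_has_chain[OF inv] positive by blast
    have Bc'': "B c'' = \<partial> z''" using others[OF \<open>c'' \<noteq> c\<close>] neg positive z'' by simp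
    have supp'': "L g = Local_Negative" if "z'' g \<noteq> 0" for g
      using reduced_chain_nonzeroD(5)[OF z''(1) that] positive by (cases "g = c''") auto
    have B'c: "B' c = (\<lambda>g. B c g + lam * B c'' g)"
      using positive by (simp add: column_addition_def)
    let ?z = "z + (\<lambda>g. lam * z'' g)"
    have "z'' c = 0" using supp'' c by fastforce
    then have "compressed_chain c ?z"
      using z(1) supp'' unfolding compressed_chain_def
      by (metis (no_types, lifting) add.right_neutral add_0 mult_zero_right plus_fun_apply)
    moreover have "B' c g = \<partial> ?z g" if "L g \<noteq> Local_Negative" for g
      unfolding B'c boundary_add boundary_scale using z(2)[OF that] Bc'' by simp
    moreover have supp': "g \<in> gens C" "gdim C c = Suc (gdim C g)" if "B' c g \<noteq> 0" for g
    proof -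
      from that have "B c g \<noteq> 0 \<or> B c'' g \<noteq> 0" by (auto simp: B'c)
      then show "g \<in> gens C" "gdim C c = Suc (gdim C g)"
        using supp reduced_chain_boundaryD[OF z''(1), of g] Bc'' positive by auto
    qed
    moreover have "B' d = B\<^sub>0 d" if "d \<noteq> c" for d
      using positive others that by (simp add: column_addition_def)
    ultimately have "column_compressed c B\<^sub>0 B'"
      unfolding column_compressed_def by blast
    moreover have "elimination_rank (gens C) idx {g. is_local (L g)} (B' c) <
      elimination_rank (gens C) idx {g. is_local (L g)} (B c)"
    proof (rule elimination_rank_less[where p = c'])
      show c': "B c c' \<noteq> 0" "c' \<in> {g. is_local (L g)}" "c' \<in> gens C"
        using positive supp by (auto simp: max_local_def)
      fix q assume q: "q \<in> {g. is_local (L g)}" "B' c q \<noteq> 0"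
      have "B' c c' = 0" unfolding B'c using positive by simp
      then have "q \<noteq> c'" using q(2) by auto
      moreover have "idx q \<le> idx c'"
      proof (cases "B c q = 0")
        case True
        then have "B c'' q \<noteq> 0" using q(2) by (auto simp: B'c)
        then show ?thesis using local_pivot_maximal[where B = B and n = c'', OF z''(1) Bc''] positive by blast
      qed (use q(1) positive in \<open>auto simp: max_local_def\<close>)
      ultimately show "idx q < idx c'"
        using c'(3) supp'(1)[OF q(2)] inj_idx by (metis inj_onD order_le_less)
    qed (rule finite_gens)
    ultimately show ?thesis by blast
  qed
qed

lemma compression_exists:
  assumes "L c = Global" "B c = A c" "\<And>n. L n = Local_Negative \<Longrightarrow> B n = A n"
  shows "\<exists>B'. exhaust (compression_step C idx L c) B B'"
proof (rule exhaust_exists[where I = "column_compressed c B"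
      and \<mu> = "\<lambda>B. elimination_rank (gens C) idx {g. is_local (L g)} (B c)"])
  show "column_compressed c B B" by (rule column_compressed_init) (rule assms)+
qed (rule compression_step_invariant[OF assms(1,3)])

text \<open>
  When the loop ends, no local entry is left: a largest one would either be negative and removable, or
  positive and hence the pivot of some negative column that could be added.
\<close>

lemma compression_result:
  assumes c: "L c = Global" "B c = A c" and neg: "\<And>n. L n = Local_Negative \<Longrightarrow> B n = A n"
    and ex: "exhaust (compression_step C idx L c) B B'"
  shows "\<forall>d. d \<noteq> c \<longrightarrow> B' d = B d"
    and "\<exists>z. compressed_chain c z \<and> (\<forall>p. L p = Local_Positive \<longrightarrow> \<partial> z p = 0) \<and>
      B' c = restrict {g. L g = Global} (\<partial> z)"
proof -
  have red: "column_compressed c B B'"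
  proof (rule exhaust_invariant[where I = "column_compressed c B", OF ex])
    show "column_compressed c B B" by (rule column_compressed_init) (rule c)+
  qed (use compression_step_invariant[OF c(1) neg] in blast)
  then show "\<forall>d. d \<noteq> c \<longrightarrow> B' d = B d" by (simp add: column_compressed_def)
  obtain z where z: "compressed_chain c z" "\<And>g. L g \<noteq> Local_Negative \<Longrightarrow> B' c g = \<partial> z g"
    and supp: "\<And>g. B' c g \<noteq> 0 \<Longrightarrow> g \<in> gens C" "\<And>g. B' c g \<noteq> 0 \<Longrightarrow> gdim C c = Suc (gdim C g)"
    using red by (auto simp: column_compressed_def)
  have no_local: "B' c g = 0" if "is_local (L g)" for g
  proof (rule ccontr)
    assume "B' c g \<noteq> 0"
    let ?S = "{g. B' c g \<noteq> 0 \<and> is_local (L g)}"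
    have S: "finite ?S" "?S \<noteq> {}"
      using supp(1) finite_gens that \<open>B' c g \<noteq> 0\<close> by (auto intro: finite_subset[of _ "gens C"])
    then have "Max (idx ` ?S) \<in> idx ` ?S" by (intro Max_in) auto
    then obtain q where q: "q \<in> ?S" "idx q = Max (idx ` ?S)" by auto
    have "idx g \<le> idx q" if "g \<in> ?S" for g
      unfolding q(2) using S(1) that by (intro Max_ge) auto
    with q(1) have q: "max_local idx L B' c q" "B' c q \<noteq> 0" "is_local (L q)" by (auto simp: max_local_def)
    have "\<exists>B''. compression_step C idx L c B' B''"
    proof (cases "L q = Local_Negative")
      case True
      with q show ?thesis by (blast intro: compression_step.negative)
    next
      case False
      with q(3) have pos: "L q = Local_Positive" by (simp add: is_local_def)
      then obtain n where n: "L n = Local_Negative" "local_pivot C idx A n q"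
        using positive_is_pivot[OF inv] by blast
      then obtain z' where z': "reduced_chain L n z'" "A n = \<partial> z'"
        using reduced_has_chain[OF inv] by blast
      from n c have "n \<noteq> c" by auto
      with red have "B' n = B n" by (simp add: column_compressed_def)
      with n neg have Bn: "B' n = A n" by simp
      have nz: "A n q \<noteq> 0" using n by (simp add: local_pivot_def)
      then have "gdim C n = gdim C c"
        using reduced_chain_boundaryD(2)[OF z'(1), of q] z'(2) supp(2)[OF q(2)] by simp
      moreover have "n \<in> gens C" using labeled_in_gens[OF inv] n by simp
      moreover have "local_pivot C idx B' n q" using n(2) Bn by (simp add: local_pivot_def)
      moreover have "B' c q + (- B' c q / A n q) * B' n q = 0" using nz Bn by simp
      ultimately show ?thesis
        using compression_step.positive[OF q(1) pos] n(1) by blast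
    qed
    with ex show False by (auto simp: exhaust_def)
  qed
  have "B' c = restrict {g. L g = Global} (\<partial> z)"
  proof
    fix g
    show "B' c g = restrict {g. L g = Global} (\<partial> z) g"
    proof (cases "L g")
      case Unlabeled
      then have "g \<notin> gens C" using processed_labeled[OF inv] by auto
      with supp(1) Unlabeled show ?thesis by (auto simp: restrict_def)
    qed (use no_local z(2) in \<open>auto simp: restrict_def is_local_def\<close>)
  qed
  moreover have "\<partial> z p = 0" if "L p = Local_Positive" for p
    using z(2)[of p] no_local[of p] that by (simp add: is_local_def)
  ultimately show "\<exists>z. compressed_chain c z \<and> (\<forall>p. L p = Local_Positive \<longrightarrow> \<partial> z p = 0) \<and>
      B' c = restrict {g. L g = Global} (\<partial> z)"
    using z(1) by blast
qed

definition compression_invariant :: "'g set \<Rightarrow> ('g \<Rightarrow> 'g \<Rightarrow> 'f) \<Rightarrow> bool" where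
  "compression_invariant T B \<longleftrightarrow> (\<forall>d. d \<notin> T \<longrightarrow> B d = A d) \<and>
     (\<forall>c\<in>T. \<exists>z. compressed_chain c z \<and> (\<forall>p. L p = Local_Positive \<longrightarrow> \<partial> z p = 0) \<and>
        B c = restrict {g. L g = Global} (\<partial> z))"

lemma compression_prefix_invariant:
  assumes cs: "set cs = {c \<in> gens C. L c = Global}" "distinct cs" "cs = xs @ c # ys"
    and I: "compression_invariant (set xs) B"
    and ex: "exhaust (compression_step C idx L c) B B'"
  shows "compression_invariant (set (xs @ [c])) B'"
proof -
  have c: "L c = Global" "c \<notin> set xs" and xs: "\<And>d. d \<in> set xs \<Longrightarrow> L d = Global"
    using cs by auto
  have "n \<notin> set xs" if "L n = Local_Negative" for n
    using that xs[of n] by auto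
  with c have "B c = A c" "\<And>n. L n = Local_Negative \<Longrightarrow> B n = A n"
    using I by (simp_all add: compression_invariant_def)
  note res = compression_result[OF c(1) this ex]
  show ?thesis
    unfolding compression_invariant_def
  proof (intro conjI allI impI ballI)
    show "B' d = A d" if "d \<notin> set (xs @ [c])" for d
      using that res(1) I by (auto simp: compression_invariant_def)
    show "\<exists>z. compressed_chain d z \<and> (\<forall>p. L p = Local_Positive \<longrightarrow> \<partial> z p = 0) \<and>
        B' d = restrict {g. L g = Global} (\<partial> z)" if "d \<in> set (xs @ [c])" for d
    proof (cases "d = c")
      case True
      with res(2) show ?thesis by simp
    next
      case False
      with that res(1) I show ?thesis by (auto simp: compression_invariant_def)
    qed
  qed
qed

lemma phase_II_exists: "\<exists>B. phase_II C idx L A B"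
proof -
  obtain cs where cs: "set cs = {c \<in> gens C. L c = Global}" "distinct cs"
    using finite_distinct_list[of "{c \<in> gens C. L c = Global}"] finite_gens by auto
  have "\<exists>B. for_each (\<lambda>c. exhaust (compression_step C idx L c)) cs A B"
  proof (rule for_each_exists[where xs = "[]" and cs = cs
        and I = "\<lambda>xs. compression_invariant (set xs)"])
    show "\<exists>B'. exhaust (compression_step C idx L c) B B'"
      if "cs = xs @ c # ys" "compression_invariant (set xs) B" for xs c ys B
    proof (rule compression_exists)
      have glob: "L d = Global" if "d \<in> set cs" for d using that cs by auto
      then show "L c = Global" using that(1) by simp
      show "B c = A c" using that cs(2) by (simp add: compression_invariant_def)
      fix n assume "L n = Local_Negative"
      then have "n \<notin> set xs" using glob[of n] that(1) by auto
      then show "B n = A n" using that(2) by (simp add: compression_invariant_def)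
    qed
    show "compression_invariant (set []) A" by (simp add: compression_invariant_def)
  qed (use compression_prefix_invariant[OF cs] in auto)
  with cs show ?thesis by (auto simp: phase_II_def)
qed

lemma phase_II_result:
  assumes "phase_II C idx L A B"
  shows "compression_invariant {c \<in> gens C. L c = Global} B"
proof -
  obtain cs where cs: "set cs = {c \<in> gens C. L c = Global}" "distinct cs"
    and fe: "for_each (\<lambda>c. exhaust (compression_step C idx L c)) cs A B"
    using assms by (auto simp: phase_II_def)
  have "compression_invariant (set cs) B"
  proof (rule for_each_invariant[OF fe, where xs = "[]" and I = "\<lambda>xs. compression_invariant (set xs)"])
    show "compression_invariant (set []) A" by (simp add: compression_invariant_def)
  qed (use compression_prefix_invariant[OF cs] in auto)
  with cs show ?thesis by simp
qed

lemma chunk_correct: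
  assumes "phase_II C idx L A B"
  shows "bifiltered_complex (phase_III C L B) \<and> homotopy_equivalent (phase_III C L B) C"
proof -
  interpret cancellable C "{n. L n = Local_Negative}" "{p. L p = Local_Positive}"
    by (rule cancellable_local_pairs)
  let ?D = "phase_III C L B"
  have G: "G = {c \<in> gens C. \<not> is_local (L c)}" by (auto simp: G_def is_local_def)
  have global: "L g = Global" if "g \<in> G" for g
    using that processed_labeled[OF inv, of g] by (cases "L g") (auto simp: G_def)
  have G': "G = {g. L g = Global}"
    using global labeled_in_gens[OF inv] by (auto simp: G_def)
  have bd: "\<exists>z\<in>core. (\<forall>g\<in>G. z g = single c g) \<and> bd ?D c = restrict G (\<partial> z)" if "c \<in> G" for c
  proof -
    have "c \<in> {c \<in> gens C. L c = Global}" using that global[OF that] by (simp add: G_def)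
    then obtain z where z: "compressed_chain c z" "\<forall>p. L p = Local_Positive \<longrightarrow> \<partial> z p = 0"
      "B c = restrict {g. L g = Global} (\<partial> z)"
      using phase_II_result[OF assms] unfolding compression_invariant_def by blast
    have "z \<in> core"
      using z(1,2) that by (auto simp: core_def supp_def compressed_chain_def)
    moreover have "\<forall>g\<in>G. z g = single c g"
    proof
      fix g assume "g \<in> G"
      then have "L g \<noteq> Local_Negative" by (simp add: G_def)
      with z(1) show "z g = single c g"
        by (cases "g = c") (auto simp: compressed_chain_def single_def)
    qed
    ultimately show ?thesis
      using z(3) by (auto simp: phase_III_def G')
  qed
  have D: "gens ?D = G" "gdim ?D = gdim C" "gval ?D = gval C"
    by (auto simp: phase_III_def G)
  show ?thesis
    using bifiltered_complex_D[OF D bd] homotopy_equivalent_D[OF D bd] by blast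
qed

end

end

theorem theorem1:
  fixes C :: "('g, 'f::field) bifiltered" and idx :: "'g \<Rightarrow> 'i::linorder"
  assumes "bifiltered_complex C" and "index_function C idx"
  shows "(\<exists>Cbar. chunk_output C idx Cbar) \<and>
         (\<forall>Cbar. chunk_output C idx Cbar \<longrightarrow>
            bifiltered_complex Cbar \<and> homotopy_equivalent Cbar C)"
proof -
  interpret indexed_complex C idx
    using assms by unfold_locales
  obtain B L where I: "phase_I C idx (B, L)" using phase_I_exists by blast
  then obtain B' where "phase_II C idx L B B'" using phase_II_exists phase_I_invariant by blast
  with I have "\<exists>Cbar. chunk_output C idx Cbar" by (auto simp: chunk_output_def)
  moreover have "bifiltered_complex Cbar \<and> homotopy_equivalent Cbar C"
    if out: "chunk_output C idx Cbar" for Cbar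
  proof -
    from out obtain B L B' where "phase_I C idx (B, L)" "phase_II C idx L B B'"
      and "Cbar = phase_III C L B'"
      by (auto simp: chunk_output_def)
    with chunk_correct phase_I_invariant show ?thesis by blast
  qed
  ultimately show ?thesis by blast
qed

end
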